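(* Let $(x,\varepsilon,\lambda_0,y)$ be an extremal tuple on $[s_-,s_+]$ such that $\varepsilon\in\mathbb F^{\mathrm{sym}}$, $s_+=-s_->0$, $s_\pm=s_\pm^{\varepsilon}$, and $x(s_\pm)=\pm n_\infty$. Assume $\lambda_0>0$ and $I^{\mathrm{centr}}\ne(s_-,s_+)$. (i) Let $I\subset(s_-,s_+)$ be an ordinary layer. Then $I=(b_j,b_{j+1})$ for a certain $j\in\mathbb Z$, and $|I|<\frac{\pi}{2n_1\operatorname{Re}\kappa}$ whenever $\varepsilon(b_j+0)=n_1^2$, while $\frac{\pi}{2n_2\operatorname{Re}\kappa}<|I|<\frac{\pi}{n_2\operatorname{Re}\kappa}$ whenever $\varepsilon(b_j+0)=n_2^2$. (ii) If $\epsilon_{\mathrm{edge}}=n_1^2$, then $|I^\pm|<\frac{\pi}{2n_1\operatorname{Re}\kappa}$; if $\epsilon_{\mathrm{edge}}=n_2^2$, then $|I^\pm|<\frac{\pi}{n_1\operatorname{Re}\kappa}$. In particular, the first case takes place when $n_\infty=n_2$, and the second when $n_\infty=n_1$. (iii) If $x(0)=0$, then $|I^{\mathrm{centr}}|<\frac{\pi}{\epsilon_{\mathrm{centr}}^{1/2}\operatorname{Re}\kappa}$. (iv) Let $x(0)=\infty$ and $n_\infty\in[n_1,n_2]$. If $\epsilon_{\mathrm{centr}}=n_2^2$, then $\frac{\pi}{n_2\operatorname{Re}\kappa}<|I^{\mathrm{centr}}|<\frac{2\pi}{n_2\operatorname{Re}\kappa}$; if $\epsilon_{\mathrm{centr}}=n_1^2$,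 then $|I^{\mathrm{centr}}|<\frac{\pi}{n_1\operatorname{Re}\kappa}$.
   Context: Fix constants $0<n_1<n_2$, $n_\infty>0$, and $\kappa\in\mathbb C$ with $\operatorname{Re}\kappa>0$, $\operatorname{Im}\kappa<0$. $\mathbb C_+=\{\operatorname{Im}z>0\}$; $|I|$ is the length of an interval $I$. $\mathbb F^{\mathrm{sym}}$ is the family of even positive $\varepsilon\in L^\infty(\mathbb R;\mathbb R)$ for which there exist $a_-\le a_+$ with $\varepsilon=n_\infty^2$ a.e. outside $[a_-,a_+]$ and $n_1^2\le\varepsilon\le n_2^2$ a.e. in $(a_-,a_+)$; for $\varepsilon\not\equiv n_\infty^2$, $[s_-^\varepsilon,s_+^\varepsilon]$ is the shortest interval outside of which $\varepsilon=n_\infty^2$ a.e. $(x,\varepsilon,\lambda_0,y)$ is an extremal tuple on $[s_-,s_+]$ if $y$ is a nontrivial solution of $y''=-\kappa^2\varepsilon y$ on $[s_-,s_+]$, $\varepsilon(s)=n_1^2$ when $\operatorname{Im}y^2(s)<0$ and $\varepsilon(s)=n_2^2$ when $\operatorname{Im}y^2(s)>0$ ($s\in[s_-,s_+]$), $x=\frac{y'}{\mathrm i\kappa y}$ ($=\infty$ where $y=0$), and $\operatorname{Im}(\varepsilon(s)y^2(s)+\kappa^{-2}(y'(s))^2)=\lambda_0\ge0$ on $[s_-,s_+]$. The function $y$ extends uniquely from $[s_-,s_+]$ to a solution on $\mathbb R$ of $-y''=\kappa^2y\,\mathcal E(y)$, where $\mathcal E(y)=n_1^2+(n_2^2-n_1^2)\chi_{\mathbb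 C_+}(y^2)$; the switch points are the jump points of the extended control $\mathcal E(y)$ on $\mathbb R$ (which coincides with $\varepsilon$ on $[s_-,s_+]$). They form a strictly increasing sequence $\{b_j\}_{j\in\mathbb Z}$, unbounded in both directions. Under the symmetry assumptions of the claim, $0$ is not a switch point and $x(0)\in\{0,\infty\}$. Let $\tilde b_1$ be the smallest positive and $\tilde b_{-1}$ the largest negative switch point. Layers of $\varepsilon$ in $(s_-,s_+)$ are maximal open subintervals of $(s_-,s_+)$ on which $\varepsilon$ is constant. The central layer $I^{\mathrm{centr}}$ equals $(\tilde b_{-1},\tilde b_1)$ if $\tilde b_{\pm1}\in[s_-,s_+]$ and equals $(s_-,s_+)$ if $\tilde b_1\ge s_+$; $\epsilon_{\mathrm{centr}}$ is the constant value of $\varepsilon$ in it. The right (left) edge layer $I^+$ (resp. $I^-$) is the largest subinterval $I\ne I^{\mathrm{centr}}$ of $(s_-,s_+)$ of the form $(s,s_+)$ (resp. $(s_-,s)$) containing no switch points; the common constant value of $\varepsilon$ in $I^-$ and $I^+$ is $\epsilon_{\mathrm{edge}}$. A layer in $(s_-,s_+)$ that is neither central nor an edge layer is called ordinary. *)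

theory Defs
  imports "HOL-Analysis.Analysis"
begin

text \<open>
  Elements of L-infinity are represented by Lebesgue measurable functions on the real line, and
  every condition on them is imposed almost everywhere, so that nothing below depends on the
  choice of a representative.
\<close>

definition ae_const_on :: "(real \<Rightarrow> real) \<Rightarrow> real set \<Rightarrow> real \<Rightarrow> bool" where
  "ae_const_on \<epsilon> I c \<longleftrightarrow> (AE s\<in>I in lebesgue. \<epsilon> s = c)"

definition const_value :: "(real \<Rightarrow> real) \<Rightarrow> real set \<Rightarrow> real" where
  "const_value \<epsilon> I = (THE c. ae_const_on \<epsilon> I c)"

text \<open>\<open>ess_right_lim \<epsilon> b c\<close> is \<open>\<epsilon>(b+0) = c\<close> for a class \<open>\<epsilon>\<close> of functions modulo null sets.\<close>

definition ess_right_lim :: "(real \<Rightarrow> real) \<Rightarrow> real \<Rightarrow> real \<Rightarrow> bool" where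
  "ess_right_lim \<epsilon> b c \<longleftrightarrow>
     (\<forall>e>0. \<exists>d>0. AE s\<in>{b<..<b + d} in lebesgue. \<bar>\<epsilon> s - c\<bar> < e)"

definition Fsym :: "real \<Rightarrow> real \<Rightarrow> real \<Rightarrow> (real \<Rightarrow> real) set" where
  "Fsym n1 n2 ninf = {\<epsilon>. \<epsilon> \<in> borel_measurable lebesgue
     \<and> (\<exists>C. AE s in lebesgue. \<bar>\<epsilon> s\<bar> \<le> C)
     \<and> (AE s in lebesgue. \<epsilon> (- s) = \<epsilon> s)
     \<and> (AE s in lebesgue. 0 < \<epsilon> s)
     \<and> (\<exists>am ap. am \<le> ap
          \<and> (AE s\<in>- {am..ap} in lebesgue. \<epsilon> s = ninf\<^sup>2)
          \<and> (AE s\<in>{am<..<ap} in lebesgue. n1\<^sup>2 \<le> \<epsilon> s \<and> \<epsilon> s \<le> n2\<^sup>2))}"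

text \<open>\<open>shortest_interval ninf \<epsilon> sm sp\<close> says that \<open>\<epsilon>\<close> is not identically \<open>ninf\<^sup>2\<close> and that
  \<open>sm\<close>, \<open>sp\<close> are the points \<open>s\<^sub>-\<^sup>\<epsilon>\<close>, \<open>s\<^sub>+\<^sup>\<epsilon>\<close>.\<close>

definition shortest_interval :: "real \<Rightarrow> (real \<Rightarrow> real) \<Rightarrow> real \<Rightarrow> real \<Rightarrow> bool" where
  "shortest_interval ninf \<epsilon> sm sp \<longleftrightarrow>
     \<not> (AE s in lebesgue. \<epsilon> s = ninf\<^sup>2)
     \<and> sm \<le> sp \<and> ae_const_on \<epsilon> (- {sm..sp}) (ninf\<^sup>2)
     \<and> (\<forall>a b. a \<le> b \<and> ae_const_on \<epsilon> (- {a..b}) (ninf\<^sup>2) \<longrightarrow> sp - sm \<le> b - a)"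

text \<open>Solutions of \<open>u'' = q u\<close> on an interval \<open>S\<close> with an L-infinity coefficient \<open>q\<close>, in the
  Caratheodory sense: \<open>u\<close> is differentiable and \<open>u'\<close> is the indefinite Lebesgue integral of
  \<open>q u\<close>. At endpoints of \<open>S\<close> the derivative is one-sided.\<close>

definition solves_ode :: "real set \<Rightarrow> (real \<Rightarrow> complex) \<Rightarrow> (real \<Rightarrow> complex) \<Rightarrow> bool" where
  "solves_ode S q u \<longleftrightarrow>
     (\<forall>s\<in>S. u differentiable (at s within S))
     \<and> (\<forall>a\<in>S. \<forall>b\<in>S. a \<le> b \<longrightarrow>
          (\<lambda>s. q s * u s) absolutely_integrable_on {a..b}
          \<and> ((\<lambda>s. q s * u s) has_integral
               (vector_derivative u (at b within S) - vector_derivative u (at a within S))) {a..b})"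

text \<open>The Riemann sphere: \<open>None\<close> is the point at infinity.\<close>

type_synonym sphere = "complex option"

definition extremal_tuple ::
  "real \<Rightarrow> real \<Rightarrow> complex \<Rightarrow> real \<Rightarrow> real
     \<Rightarrow> (real \<Rightarrow> sphere) \<Rightarrow> (real \<Rightarrow> real) \<Rightarrow> real \<Rightarrow> (real \<Rightarrow> complex) \<Rightarrow> bool" where
  "extremal_tuple n1 n2 \<kappa> sm sp x \<epsilon> lam0 y \<longleftrightarrow>
     (let dy = (\<lambda>s. vector_derivative y (at s within {sm..sp})) in
       solves_ode {sm..sp} (\<lambda>s. - \<kappa>\<^sup>2 * of_real (\<epsilon> s)) y
       \<and> (\<exists>s\<in>{sm..sp}. y s \<noteq> 0)
       \<and> (AE s\<in>{sm..sp} in lebesgue.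
            (Im ((y s)\<^sup>2) < 0 \<longrightarrow> \<epsilon> s = n1\<^sup>2) \<and> (Im ((y s)\<^sup>2) > 0 \<longrightarrow> \<epsilon> s = n2\<^sup>2))
       \<and> (\<forall>s\<in>{sm..sp}. x s = (if y s = 0 then None else Some (dy s / (\<i> * \<kappa> * y s))))
       \<and> (AE s\<in>{sm..sp} in lebesgue.
            Im (of_real (\<epsilon> s) * (y s)\<^sup>2 + (dy s)\<^sup>2 / \<kappa>\<^sup>2) = lam0)
       \<and> lam0 \<ge> 0)"

definition control :: "real \<Rightarrow> real \<Rightarrow> complex \<Rightarrow> real" where
  "control n1 n2 z = n1\<^sup>2 + (n2\<^sup>2 - n1\<^sup>2) * indicator {w. Im w > 0} (z\<^sup>2)"

definition extends_to ::
  "real \<Rightarrow> real \<Rightarrow> complex \<Rightarrow> real \<Rightarrow> real \<Rightarrow> (real \<Rightarrow> complex) \<Rightarrow> (real \<Rightarrow> complex) \<Rightarrow> bool" where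
  "extends_to n1 n2 \<kappa> sm sp y Y \<longleftrightarrow>
     (\<forall>s\<in>{sm..sp}. Y s = y s)
     \<and> solves_ode UNIV (\<lambda>s. - \<kappa>\<^sup>2 * of_real (control n1 n2 (Y s))) Y"

text \<open>A point where \<open>Im (Y\<^sup>2)\<close> vanishes without changing sign is not a jump of the control: the
  one-sided limits ignore the value at the point itself.\<close>

definition switch_points :: "real \<Rightarrow> real \<Rightarrow> (real \<Rightarrow> complex) \<Rightarrow> real set" where
  "switch_points n1 n2 Y = {b. \<exists>l r. l \<noteq> r
     \<and> ((\<lambda>s. control n1 n2 (Y s)) \<longlongrightarrow> l) (at_left b)
     \<and> ((\<lambda>s. control n1 n2 (Y s)) \<longlongrightarrow> r) (at_right b)}"

definition switch_sequence :: "real \<Rightarrow> real \<Rightarrow> (real \<Rightarrow> complex) \<Rightarrow> (int \<Rightarrow> real) \<Rightarrow> bool" where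
  "switch_sequence n1 n2 Y b \<longleftrightarrow>
     strict_mono b \<and> range b = switch_points n1 n2 Y
     \<and> \<not> bdd_above (range b) \<and> \<not> bdd_below (range b)"

text \<open>In the definitions below \<open>B\<close> is the set of switch points.\<close>

definition first_pos :: "real set \<Rightarrow> real" where
  "first_pos B = (LEAST t. t \<in> B \<and> 0 < t)"

definition first_neg :: "real set \<Rightarrow> real" where
  "first_neg B = (GREATEST t. t \<in> B \<and> t < 0)"

definition central_layer :: "real \<Rightarrow> real \<Rightarrow> real set \<Rightarrow> real set" where
  "central_layer sm sp B =
     (if first_neg B \<in> {sm..sp} \<and> first_pos B \<in> {sm..sp}
      then {first_neg B<..<first_pos B} else {sm<..<sp})"

text \<open>Largest with respect to inclusion.\<close>

definition right_edge_layer :: "real \<Rightarrow> real \<Rightarrow> real set \<Rightarrow> real set" where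
  "right_edge_layer sm sp B =
     (GREATEST I. (\<exists>s. sm \<le> s \<and> s < sp \<and> I = {s<..<sp})
        \<and> I \<noteq> central_layer sm sp B \<and> I \<inter> B = {})"

definition left_edge_layer :: "real \<Rightarrow> real \<Rightarrow> real set \<Rightarrow> real set" where
  "left_edge_layer sm sp B =
     (GREATEST I. (\<exists>s. sm < s \<and> s \<le> sp \<and> I = {sm<..<s})
        \<and> I \<noteq> central_layer sm sp B \<and> I \<inter> B = {})"

definition eps_centr :: "(real \<Rightarrow> real) \<Rightarrow> real \<Rightarrow> real \<Rightarrow> real set \<Rightarrow> real" where
  "eps_centr \<epsilon> sm sp B = const_value \<epsilon> (central_layer sm sp B)"

definition eps_edge :: "(real \<Rightarrow> real) \<Rightarrow> real \<Rightarrow> real \<Rightarrow> real set \<Rightarrow> real" where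
  "eps_edge \<epsilon> sm sp B = const_value \<epsilon> (left_edge_layer sm sp B \<union> right_edge_layer sm sp B)"

definition const_interval :: "(real \<Rightarrow> real) \<Rightarrow> real \<Rightarrow> real \<Rightarrow> real set \<Rightarrow> bool" where
  "const_interval \<epsilon> sm sp I \<longleftrightarrow>
     (\<exists>p q. p < q \<and> I = {p<..<q}) \<and> I \<subseteq> {sm<..<sp} \<and> (\<exists>c. ae_const_on \<epsilon> I c)"

definition is_layer :: "(real \<Rightarrow> real) \<Rightarrow> real \<Rightarrow> real \<Rightarrow> real set \<Rightarrow> bool" where
  "is_layer \<epsilon> sm sp I \<longleftrightarrow> const_interval \<epsilon> sm sp I
     \<and> (\<forall>J. const_interval \<epsilon> sm sp J \<and> I \<subseteq> J \<longrightarrow> J = I)"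

definition ordinary_layer :: "(real \<Rightarrow> real) \<Rightarrow> real \<Rightarrow> real \<Rightarrow> real set \<Rightarrow> real set \<Rightarrow> bool" where
  "ordinary_layer \<epsilon> sm sp B I \<longleftrightarrow> is_layer \<epsilon> sm sp I
     \<and> I \<noteq> central_layer sm sp B
     \<and> I \<noteq> left_edge_layer sm sp B \<and> I \<noteq> right_edge_layer sm sp B"

abbreviation len :: "real set \<Rightarrow> real" where
  "len I \<equiv> measure lebesgue I"

end

theory Submission
  imports Defs
begin

text \<open>
  Write \<open>x = Y' / (\<i> \<kappa> Y)\<close>. Two currents of the profile carry the proof: \<open>rot = Im (Y' cnj Y)\<close>, which is
  \<open>\<bar>Y\<bar>\<^sup>2\<close> times the angular velocity of \<open>Y\<close>, and \<open>flux = Re (Y' cnj Y / (\<i> \<kappa>))\<close>, which is \<open>\<bar>Y\<bar>\<^sup>2 Re x\<close>. Because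
  \<open>Re \<kappa> > 0 > Im \<kappa>\<close>, both are strictly increasing (\<open>rot_strict_mono\<close>, \<open>flux_strict_mono\<close>). By
  symmetry and the radiation conditions the Wronskian of \<open>Y\<close> and its reflection vanishes
  (\<open>wronskian_zero\<close>), so both currents vanish at \<open>0\<close>. To the right of \<open>0\<close> the profile therefore turns
  counterclockwise and \<open>Re x > 0\<close>; the left half is a mirror image.

  Counterclockwise rotation makes all zeros of \<open>Im Y\<^sup>2\<close> in \<open>(0, S)\<close> transversal. So they are exactly the
  switch points, layers of high index begin where \<open>Y\<^sup>2 > 0\<close>, and layers of low index where \<open>Y\<^sup>2 < 0\<close>. At such
  a point \<open>p\<close> the conserved quantity \<open>Im (\<epsilon> Y\<^sup>2 + Y'\<^sup>2 / \<kappa>\<^sup>2) = \<lambda>\<^sub>0 > 0\<close> reduces to \<open>- Y\<^sup>2 Im x\<^sup>2 = \<lambda>\<^sub>0\<close>. With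
  \<open>Re x > 0\<close> this means \<open>Im x < 0\<close> at the beginning of a layer of high index and \<open>Im x > 0\<close> at the
  beginning of a layer of low index (\<open>impedance_at_zero\<close>).

  On a layer of index \<open>n\<close> that begins at \<open>p\<close> the equation is solved explicitly. With
  \<open>\<kappa> n (s - p) = w - \<i> r\<close>, where \<open>r \<ge> 0\<close>, and \<open>X = x p\<close>,
  \<open>Re (Y s / Y p) = cos w * (cosh r + (Re X / n) * sinh r) - (Im X / n) * sin w * cosh r\<close>
  (\<open>relative_profile\<close>). As \<open>Y\<^sup>2\<close> is real at \<open>p\<close>, it is real again wherever this expression vanishes, so the
  layer cannot extend beyond the first zero. If \<open>Im X > 0\<close>, the expression is negative at \<open>w = pi / 2\<close>. If
  \<open>Im X < 0\<close>, it is positive up to \<open>w = pi / 2\<close> and negative at \<open>w = pi\<close>. This gives the bounds for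
  ordinary and for edge layers (\<open>layer_low_index\<close>, \<open>layer_high_index_upper\<close>,
  \<open>layer_high_index_lower\<close>). The energy identity at \<open>S\<close>, where \<open>x = n\<^sub>\<infinity>\<close>, selects the index of the edge
  layers (\<open>edge_energy\<close>). On the central layer \<open>Y\<close> is a multiple of a cosine or a sine with complex
  argument, and comparing the sign of \<open>Im Y\<^sup>2\<close> at phases \<open>pi / 2\<close> and \<open>pi\<close> gives the remaining bounds
  (\<open>central_even_profile\<close>, \<open>central_odd_low_index\<close>, \<open>central_odd_high_index\<close>).
\<close>

section \<open>A product rule for indefinite integrals\<close>

text \<open>
  Lets an almost everywhere identity between derivatives be integrated without any differentiation
  theorem: increments that are quadratic in the step make a function constant.
\<close>

lemma has_derivative_zero_of_quadratic:
  fixes P :: "real \<Rightarrow> complex"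
  assumes K: "\<And>s t. s \<in> I \<Longrightarrow> t \<in> I \<Longrightarrow> s \<le> t \<Longrightarrow> norm (P t - P s) \<le> K * (t - s)\<^sup>2"
    and x: "x \<in> I"
  shows "(P has_derivative (\<lambda>h. 0)) (at x within I)"
proof (rule has_derivativeI_sandwich [of 1 _ _ _ _ "\<lambda>y. K * \<bar>y - x\<bar>"])
  show "((\<lambda>y. K * \<bar>y - x\<bar>) \<longlongrightarrow> 0) (at x within I)"
    by (auto intro!: tendsto_eq_intros)
  fix y assume y: "y \<in> I" "y \<noteq> x"
  have "norm (P y - P x) \<le> K * (y - x)\<^sup>2"
    using K[of x y] K[of y x] x y by (cases "x \<le> y") (auto simp: norm_minus_commute power2_commute)
  also have "\<dots> = K * \<bar>y - x\<bar> * norm (y - x)"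
    by (simp add: power2_eq_square)
  finally show "norm (P y - P x - 0) / norm (y - x) \<le> K * \<bar>y - x\<bar>"
    using y by (simp add: divide_simps)
qed auto

text \<open>
  \<open>D\<close> is an indefinite integral of a bounded \<open>h\<close>, which need not have one-sided limits, so the classical
  product rule does not apply to \<open>D\<close>. The difference between \<open>D * u\<close> and the integral of
  \<open>h * u + D * u'\<close> over \<open>[s, t]\<close> is the integral of \<open>h r * (u t - u r) + (D s - D r) * u' r\<close>, and this
  is of order \<open>(t - s)\<^sup>2\<close> because \<open>D\<close> and \<open>u\<close> are Lipschitz.
\<close>

lemma product_has_integral:
  fixes D u h u' :: "real \<Rightarrow> complex"
  assumes ab: "a \<le> b"
    and D: "\<And>s t. a \<le> s \<Longrightarrow> s \<le> t \<Longrightarrow> t \<le> b \<Longrightarrow> (h has_integral (D t - D s)) {s..t}"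
    and u: "\<And>s. s \<in> {a..b} \<Longrightarrow> (u has_vector_derivative u' s) (at s within {a..b})"
    and u': "continuous_on {a..b} u'"
    and M: "\<And>s. s \<in> {a..b} \<Longrightarrow> norm (h s) \<le> M"
  shows "((\<lambda>s. h s * u s + D s * u' s) has_integral (D b * u b - D a * u a)) {a..b}"
proof -
  let ?F = "\<lambda>s. h s * u s + D s * u' s"
  have cu: "continuous_on {a..b} u"
    by (simp add: continuous_on_eq_continuous_within has_vector_derivative_continuous[OF u])
  have h_int: "h integrable_on {a..b}" using D[of a b] ab by auto
  have D_eq: "D t = D a + integral {a..t} h" if "t \<in> {a..b}" for t
    using D[of a t] that by (auto simp: integral_unique)
  have cD: "continuous_on {a..b} D"
    by (subst continuous_on_cong[OF refl D_eq], assumption)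
       (auto intro!: continuous_intros indefinite_integral_continuous_1 h_int)
  have h_abs: "h absolutely_integrable_on {a..b}"
    by (rule absolutely_integrable_integrable_bound[of _ _ "\<lambda>_. M"]) (use M h_int in auto)
  have "(\<lambda>s. u s * h s) absolutely_integrable_on {a..b}"
    by (rule absolutely_integrable_bounded_measurable_product)
       (use cu h_abs in \<open>auto intro!: bilinear_times continuous_imp_measurable_on_sets_lebesgue
          compact_imp_bounded compact_continuous_image\<close>)
  then have hu_int: "(\<lambda>s. h s * u s) integrable_on {a..b}"
    by (simp add: mult.commute set_lebesgue_integral_eq_integral(1))
  have F_int: "?F integrable_on {a..b}"
    by (intro integrable_add hu_int integrable_continuous_interval continuous_intros cD u')
  obtain N where N: "\<And>s. s \<in> {a..b} \<Longrightarrow> norm (u' s) \<le> N"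
    using compact_imp_bounded[OF compact_continuous_image[OF u' compact_Icc]]
    unfolding bounded_iff by blast
  have M0: "0 \<le> M" using M[of a] ab norm_ge_zero order_trans by (metis atLeastAtMost_iff order_refl)
  have N0: "0 \<le> N" using N[of a] ab norm_ge_zero order_trans by (metis atLeastAtMost_iff order_refl)
  have u_int: "(u' has_integral (u t - u s)) {s..t}" if "a \<le> s" "s \<le> t" "t \<le> b" for s t
    by (rule fundamental_theorem_of_calculus)
       (use that in \<open>auto intro: has_vector_derivative_within_subset[OF u]\<close>)
  define P where "P t = D t * u t - integral {a..t} ?F" for t
  have P_incr: "norm (P t - P s) \<le> (2 * M * N) * (t - s)\<^sup>2"
    if s: "s \<in> {a..b}" and t: "t \<in> {a..b}" and st: "s \<le> t" for s t
  proof -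
    let ?E = "\<lambda>r. h r * (u t - u r) + (D s - D r) * u' r"
    have F_st: "(?F has_integral (integral {a..t} ?F - integral {a..s} ?F)) {s..t}"
    proof -
      have "integral {a..s} ?F + integral {s..t} ?F = integral {a..t} ?F"
        using s t st by (intro Henstock_Kurzweil_Integration.integral_combine
           integrable_on_subinterval[OF F_int]) auto
      then have "integral {a..t} ?F - integral {a..s} ?F = integral {s..t} ?F"
        by (rule subst) (simp only: add_diff_cancel_left')
      moreover have "?F integrable_on {s..t}"
        by (rule integrable_on_subinterval[OF F_int]) (use s t in auto)
      ultimately show ?thesis
        by (simp only: integrable_integral)
    qed
    have "((\<lambda>r. h r * u t + D s * u' r - ?F r) has_integral
        ((D t - D s) * u t + D s * (u t - u s) - (integral {a..t} ?F - integral {a..s} ?F))) {s..t}"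
      using s t st by (intro has_integral_diff has_integral_add has_integral_mult_left
         has_integral_mult_right D u_int F_st) auto
    moreover have "(D t - D s) * u t + D s * (u t - u s)
        - (integral {a..t} ?F - integral {a..s} ?F) = P t - P s"
      by (simp add: P_def algebra_simps)
    moreover have "(\<lambda>r. h r * u t + D s * u' r - ?F r) = ?E"
      by (auto simp: algebra_simps)
    ultimately have E: "(?E has_integral (P t - P s)) {s..t}" by simp
    have E_le: "norm (?E r) \<le> 2 * M * N * (t - s)" if r: "r \<in> {s..t}" for r
    proof -
      have "norm (u t - u r) \<le> N * (t - r)"
        using has_integral_bound_real[OF N0 finite.emptyI, of u' "u t - u r" r t] u_int[of r t] r s t st N by auto
      moreover have "norm (D r - D s) \<le> M * (r - s)"
        using has_integral_bound_real[OF M0 finite.emptyI, of h "D r - D s" s r] D[of s r] r s t st M by auto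
      ultimately have "norm (h r) * norm (u t - u r) \<le> M * (N * (t - r))"
          "norm (D s - D r) * norm (u' r) \<le> M * (r - s) * N"
        using r s t M0 N0 by (auto simp: norm_minus_commute intro!: mult_mono[OF M] mult_mono[OF _ N])
      then have "norm (?E r) \<le> M * (N * (t - r)) + M * (r - s) * N"
        by (intro norm_triangle_le) (simp add: norm_mult)
      also have "\<dots> = M * N * (t - s)" by (simp add: algebra_simps)
      also have "\<dots> \<le> 2 * (M * N * (t - s))" using st M0 N0 by simp
      finally show ?thesis by simp
    qed
    have "norm (P t - P s) \<le> 2 * M * N * (t - s) * Henstock_Kurzweil_Integration.content {s..t}"
      by (rule has_integral_bound_real[OF _ finite.emptyI E]) (use E_le st M0 N0 in auto)
    then show ?thesis using st by (simp add: power2_eq_square)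
  qed
  have "\<exists>k. \<forall>x\<in>{a..b}. P x = k"
    by (rule has_derivative_zero_constant)
       (auto intro: has_derivative_zero_of_quadratic[OF P_incr])
  then have "P b = P a" using ab by auto
  then have "integral {a..b} ?F = D b * u b - D a * u a"
    by (simp add: P_def algebra_simps)
  then show ?thesis using integrable_integral[OF F_int] by (simp only:)
qed

section \<open>Extremal profiles and their currents\<close>

text \<open>
  An extremal tuple on \<open>[- S, S]\<close> seen through the extension \<open>Y\<close>, with \<open>d\<close> in the role of \<open>Y'\<close> and \<open>lam\<close>
  in that of \<open>\<lambda>\<^sub>0\<close>. Working with \<open>Y\<close> makes all derivatives two-sided and replaces \<open>\<epsilon>\<close> in the equation
  by a coefficient that is bounded everywhere and not just almost everywhere. The radiation
  conditions are \<open>x (\<plusminus>S) = \<plusminus>ninf\<close>.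
\<close>

locale extremal_profile =
  fixes n1 n2 ninf lam S :: real and \<kappa> :: complex and \<epsilon> :: "real \<Rightarrow> real"
    and Y d :: "real \<Rightarrow> complex" and b :: "int \<Rightarrow> real"
  assumes n1_pos: "0 < n1" and n1_less_n2: "n1 < n2"
    and Re_\<kappa>: "0 < Re \<kappa>" and Im_\<kappa>: "Im \<kappa> < 0" and S_pos: "0 < S" and lam_pos: "0 < lam"
    and Y_deriv: "\<And>s. (Y has_vector_derivative d s) (at s)"
    and d_integral: "\<And>s t. s \<le> t \<Longrightarrow>
      ((\<lambda>r. - \<kappa>\<^sup>2 * of_real (control n1 n2 (Y r)) * Y r) has_integral (d t - d s)) {s..t}"
    and eps_even: "AE s in lebesgue. \<epsilon> (- s) = \<epsilon> s"
    and eps_bang: "AE s\<in>{- S..S} in lebesgue.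
      (Im ((Y s)\<^sup>2) < 0 \<longrightarrow> \<epsilon> s = n1\<^sup>2) \<and> (Im ((Y s)\<^sup>2) > 0 \<longrightarrow> \<epsilon> s = n2\<^sup>2)"
    and energy_AE: "AE s\<in>{- S..S} in lebesgue.
      Im (of_real (\<epsilon> s) * (Y s)\<^sup>2 + (d s)\<^sup>2 / \<kappa>\<^sup>2) = lam"
    and radiation_right: "d S = \<i> * \<kappa> * of_real ninf * Y S"
    and radiation_left: "d (- S) = - (\<i> * \<kappa> * of_real ninf * Y (- S))"
    and switches: "switch_sequence n1 n2 Y b"
begin

definition im_sq :: "real \<Rightarrow> real" where "im_sq s = Im ((Y s)\<^sup>2)"

definition ctrl :: "real \<Rightarrow> real" where "ctrl s = control n1 n2 (Y s)"

lemma ctrl_eq: "ctrl s = (if 0 < im_sq s then n2\<^sup>2 else n1\<^sup>2)"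
  by (auto simp: ctrl_def im_sq_def control_def indicator_def)

lemma n_sq: "0 < n1\<^sup>2" "n1\<^sup>2 < n2\<^sup>2" "0 < n2\<^sup>2"
  using n1_pos n1_less_n2 by (auto intro: power_strict_mono)

lemma \<kappa>_nz: "\<kappa> \<noteq> 0"
  using Re_\<kappa> by auto

lemma ctrl_bounds: "n1\<^sup>2 \<le> ctrl s" "ctrl s \<le> n2\<^sup>2" "0 < ctrl s"
  using n_sq by (auto simp: ctrl_eq)

lemma d_integral': "s \<le> t \<Longrightarrow> ((\<lambda>r. - \<kappa>\<^sup>2 * of_real (ctrl r) * Y r) has_integral (d t - d s)) {s..t}"
  using d_integral by (simp add: ctrl_def)

lemma continuous_on_Y: "continuous_on A Y"
  by (rule continuous_at_imp_continuous_on) (simp add: has_vector_derivative_continuous[OF Y_deriv])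

lemma ode_rhs_bounded: "\<exists>M. \<forall>s\<in>{p..q}. norm (- \<kappa>\<^sup>2 * of_real (ctrl s) * Y s) \<le> M"
proof -
  obtain K where K: "\<forall>z\<in>Y ` {p..q}. norm z \<le> K"
    using compact_imp_bounded[OF compact_continuous_image[OF continuous_on_Y compact_Icc]]
    unfolding bounded_iff by blast
  have "norm (- \<kappa>\<^sup>2 * of_real (ctrl s) * Y s) \<le> norm (\<kappa>\<^sup>2) * n2\<^sup>2 * K" if s: "s \<in> {p..q}" for s
  proof -
    have "norm (- \<kappa>\<^sup>2 * of_real (ctrl s) * Y s) = norm (\<kappa>\<^sup>2) * ctrl s * norm (Y s)"
      using ctrl_bounds(3)[of s] by (simp only: norm_mult norm_minus_cancel norm_of_real abs_of_pos)
    also have "\<dots> \<le> norm (\<kappa>\<^sup>2) * n2\<^sup>2 * K"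
      using s K ctrl_bounds(2,3)[of s] by (intro mult_mono' mult_left_mono) simp_all
    finally show ?thesis .
  qed
  then show ?thesis by blast
qed

lemma continuous_on_d: "continuous_on A d"
proof -
  have "isCont d s" for s
  proof -
    have int: "(\<lambda>r. - \<kappa>\<^sup>2 * of_real (ctrl r) * Y r) integrable_on {s - 1..s + 1}"
      using d_integral'[of "s - 1" "s + 1"] by auto
    have eq: "d t = integral {s - 1..t} (\<lambda>r. - \<kappa>\<^sup>2 * of_real (ctrl r) * Y r) + d (s - 1)"
      if "t \<in> {s - 1..s + 1}" for t
      using integral_unique[OF d_integral'[of "s - 1" t]] that by (simp only: diff_add_cancel atLeastAtMost_iff)
    have "continuous_on {s - 1..s + 1} d"
      by (subst continuous_on_cong[OF refl eq], assumption)
         (intro continuous_intros indefinite_integral_continuous_1 int)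
    then show ?thesis
      by (rule continuous_on_interior) auto
  qed
  then show ?thesis by (simp add: continuous_at_imp_continuous_on)
qed

lemma continuous_on_im_sq: "continuous_on A im_sq"
  unfolding im_sq_def by (intro continuous_intros continuous_on_Y)

lemma d_times_has_integral:
  assumes "p \<le> q" and "\<And>s. (u has_vector_derivative u' s) (at s)" and "continuous_on {p..q} u'"
  shows "((\<lambda>s. - \<kappa>\<^sup>2 * of_real (ctrl s) * Y s * u s + d s * u' s) has_integral (d q * u q - d p * u p)) {p..q}"
proof -
  obtain M where M: "\<forall>s\<in>{p..q}. norm (- \<kappa>\<^sup>2 * of_real (ctrl s) * Y s) \<le> M"
    using ode_rhs_bounded by blast
  show ?thesis
    by (rule product_has_integral[OF assms(1) _ has_vector_derivative_at_within[OF assms(2)] assms(3), where M = M])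
       (use d_integral' M in auto)
qed

text \<open>
  If \<open>Y s \<noteq> 0\<close>, then \<open>rot s\<close> is \<open>\<bar>Y s\<bar>\<^sup>2\<close> times the derivative of \<open>arg Y\<close>, and \<open>flux s\<close> is \<open>\<bar>Y s\<bar>\<^sup>2 Re (x s)\<close>.
\<close>

definition rot :: "real \<Rightarrow> real" where "rot s = Im (d s * cnj (Y s))"

definition flux :: "real \<Rightarrow> real" where "flux s = Re (d s * cnj (Y s) / (\<i> * \<kappa>))"

lemma current_has_integral:
  assumes "p \<le> q"
  shows "((\<lambda>s. - \<kappa>\<^sup>2 * of_real (ctrl s * (norm (Y s))\<^sup>2) + of_real ((norm (d s))\<^sup>2)) has_integral
    (d q * cnj (Y q) - d p * cnj (Y p))) {p..q}"
proof -
  have "((\<lambda>s. cnj (Y s)) has_vector_derivative cnj (d s)) (at s)" for s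
    by (rule bounded_linear.has_vector_derivative[OF bounded_linear_cnj Y_deriv])
  from d_times_has_integral[OF assms this]
  have "((\<lambda>s. - \<kappa>\<^sup>2 * of_real (ctrl s) * Y s * cnj (Y s) + d s * cnj (d s)) has_integral
    (d q * cnj (Y q) - d p * cnj (Y p))) {p..q}"
    by (simp add: continuous_on_d continuous_on_cnj)
  then show ?thesis
    by (simp only: mult.assoc complex_norm_square of_real_mult)
qed

text \<open>
  As \<open>Re \<kappa> > 0 > Im \<kappa>\<close>, the integrand is nonnegative and vanishes only where \<open>Y\<close> does.
\<close>

lemma rot_has_integral:
  assumes "p \<le> q"
  shows "((\<lambda>s. - 2 * Re \<kappa> * Im \<kappa> * (ctrl s * (norm (Y s))\<^sup>2)) has_integral (rot q - rot p)) {p..q}"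
  using has_integral_Im[OF current_has_integral[OF assms]]
  by (simp add: rot_def power2_eq_square[of \<kappa>] algebra_simps)

lemma flux_has_integral:
  assumes "p \<le> q"
  shows "((\<lambda>s. - Im \<kappa> * (ctrl s * (norm (Y s))\<^sup>2 + (norm (d s))\<^sup>2 / (norm \<kappa>)\<^sup>2)) has_integral (flux q - flux p)) {p..q}"
proof -
  have eq: "Re ((- \<kappa>\<^sup>2 * of_real A + of_real E) / (\<i> * \<kappa>)) = - Im \<kappa> * (A + E / (norm \<kappa>)\<^sup>2)" for A E :: real
  proof -
    have "(- \<kappa>\<^sup>2 * of_real A + of_real E) / (\<i> * \<kappa>) = \<i> * \<kappa> * of_real A + of_real E / (\<i> * \<kappa>)"
      using \<kappa>_nz by (simp add: field_simps power2_eq_square)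
    moreover have "Re (of_real E / (\<i> * \<kappa>)) = - Im \<kappa> * (E / (norm \<kappa>)\<^sup>2)"
      by (simp add: Re_divide cmod_power2 add.commute)
    ultimately show ?thesis by (simp add: algebra_simps)
  qed
  show ?thesis
    using has_integral_Re[OF has_integral_divide[OF current_has_integral[OF assms], of "\<i> * \<kappa>"]]
    by (simp only: eq flux_def diff_divide_distrib minus_complex.sel)
qed

end

section \<open>The energy identity and the monotonicity of the currents\<close>

lemma AE_lebesgue_iff_negligible:
  "(AE s in lebesgue. P s) \<longleftrightarrow> negligible {s :: real. \<not> P s}"
  unfolding eventually_ae_filter negligible_iff_null_sets[symmetric]
  by (auto simp: negligible_iff_null_sets[symmetric] intro: negligible_subset)

lemma AE_lebesgue_uminus:
  assumes "AE s in lebesgue. P (s :: real)"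
  shows "AE s in lebesgue. P (- s)"
proof -
  have "{s. \<not> P (- s)} = uminus ` {s. \<not> P s}"
    by (auto simp: image_iff) (metis minus_minus)
  then show ?thesis
    using assms unfolding AE_lebesgue_iff_negligible
    by (simp, intro negligible_locally_Lipschitz_image)
       (auto simp: norm_minus_commute intro!: exI[of _ "UNIV :: real set"] exI[of _ "1 :: real"])
qed

text \<open>
  A conull subset of an interval is dense in it.
\<close>

lemma AE_const_continuous_imp_const:
  fixes f :: "real \<Rightarrow> real"
  assumes f: "continuous_on UNIV f" and ab: "a < b"
    and ae: "AE s\<in>{a..b} in lebesgue. f s = k" and s: "s \<in> {a..b}"
  shows "f s = k"
proof -
  have cl: "closed {s. f s = k}"
    by (intro closed_Collect_eq f continuous_on_const)
  have "r \<in> {s. f s = k}" if "r \<in> {a<..<b}" for r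
    by (rule mem_closed_if_AE_lebesgue_open[OF _ cl _ that]) (use ae in \<open>auto elim: eventually_mono\<close>)
  then have "closure {a<..<b} \<subseteq> {s. f s = k}"
    by (intro closure_minimal cl) auto
  then show ?thesis using s ab by (auto simp: closure_greaterThanLessThan)
qed

context extremal_profile
begin

text \<open>
  Where \<open>im_sq\<close> vanishes, \<open>\<epsilon>\<close> and the control may differ, but there they do not contribute to the imaginary
  part. So the identity with the control in place of \<open>\<epsilon>\<close> holds almost everywhere, and by
  continuity everywhere.
\<close>

lemma energy:
  assumes "s \<in> {- S..S}"
  shows "ctrl s * im_sq s + Im ((d s)\<^sup>2 / \<kappa>\<^sup>2) = lam"
proof (rule AE_const_continuous_imp_const[OF _ _ _ assms])
  \<comment> \<open>The control jumps only where \<open>im_sq\<close> vanishes, hence the product is continuous.\<close>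
  have "(\<lambda>s. ctrl s * im_sq s) = (\<lambda>s. n1\<^sup>2 * min (im_sq s) 0 + n2\<^sup>2 * max (im_sq s) 0)"
    by (auto simp: ctrl_eq fun_eq_iff min_def max_def)
  then have "continuous_on UNIV (\<lambda>s. ctrl s * im_sq s)"
    by (simp only:) (intro continuous_intros continuous_on_im_sq)
  then show "continuous_on UNIV (\<lambda>s. ctrl s * im_sq s + Im ((d s)\<^sup>2 / \<kappa>\<^sup>2))"
    by (rule continuous_on_add) (use \<kappa>_nz in \<open>auto intro!: continuous_intros continuous_on_d\<close>)
  show "- S < S" using S_pos by simp
  show "AE s\<in>{- S..S} in lebesgue. ctrl s * im_sq s + Im ((d s)\<^sup>2 / \<kappa>\<^sup>2) = lam"
    using energy_AE eps_bang
  proof eventually_elim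
    case (elim s)
    then show ?case by (cases "im_sq s" "0 :: real" rule: linorder_cases) (auto simp: ctrl_eq im_sq_def)
  qed
qed

text \<open>
  The source of strictness in the monotonicity of both currents: if \<open>Y\<close> vanished on an interval, so
  would \<open>d\<close>, and the energy identity would give \<open>lam = 0\<close>.
\<close>

lemma positive_integral:
  assumes pq: "p < q" "- S \<le> p" "q \<le> S" and f: "(f has_integral F) {p..q}"
    and m: "0 < m" "\<And>s. m * (norm (Y s))\<^sup>2 \<le> f s"
  shows "0 < F"
proof (rule ccontr)
  assume "\<not> 0 < F"
  let ?m = "\<lambda>s. m * (norm (Y s))\<^sup>2"
  have "continuous_on {p..q} ?m" by (intro continuous_intros continuous_on_Y)
  then obtain G where G: "(?m has_integral G) {p..q}"
    using integrable_continuous_interval integrable_on_def by blast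
  have "G \<le> F" by (rule has_integral_le[OF G f]) (use m in auto)
  moreover have "0 \<le> G" by (rule has_integral_nonneg[OF G]) (use m in auto)
  ultimately have G0: "(?m has_integral 0) (cbox p q)" using G \<open>\<not> 0 < F\<close> by (auto dest: antisym)
  have Y0: "Y s = 0" if "s \<in> {p..q}" for s
    using has_integral_0_cbox_imp_0[OF _ _ G0, of s] \<open>continuous_on {p..q} ?m\<close> that m(1) pq by auto
  let ?s = "(p + q) / 2"
  have "(Y has_vector_derivative 0) (at ?s)"
  proof (rule has_vector_derivative_transform_within_open[of "\<lambda>_. 0" _ _ "{p<..<q}"])
    show "0 = Y x" if "x \<in> {p<..<q}" for x using Y0[of x] that by simp
  qed (use pq in auto)
  then have "d ?s = 0" using vector_derivative_unique_at[OF Y_deriv] by metis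
  moreover have "Y ?s = 0" using Y0 pq by simp
  ultimately show False
    using energy[of ?s] pq lam_pos by (auto simp: im_sq_def)
qed

lemma rot_strict_mono: "- S \<le> p \<Longrightarrow> p < q \<Longrightarrow> q \<le> S \<Longrightarrow> rot p < rot q"
proof -
  assume pq: "- S \<le> p" "p < q" "q \<le> S"
  have "0 < rot q - rot p"
  proof (rule positive_integral[OF pq(2,1,3) rot_has_integral])
    have k: "0 < - 2 * Re \<kappa> * Im \<kappa>"
      using Re_\<kappa> Im_\<kappa> by (simp add: mult_less_0_iff zero_less_mult_iff)
    then show "0 < - 2 * Re \<kappa> * Im \<kappa> * n1\<^sup>2" using n_sq(1) by (rule mult_pos_pos)
    show "- 2 * Re \<kappa> * Im \<kappa> * n1\<^sup>2 * (norm (Y s))\<^sup>2 \<le> - 2 * Re \<kappa> * Im \<kappa> * (ctrl s * (norm (Y s))\<^sup>2)" for s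
      using k ctrl_bounds(1)[of s] by (auto simp only: mult.assoc[symmetric] intro!: mult_right_mono mult_left_mono) auto
  qed (use pq in auto)
  then show ?thesis by simp
qed

lemma flux_strict_mono: "- S \<le> p \<Longrightarrow> p < q \<Longrightarrow> q \<le> S \<Longrightarrow> flux p < flux q"
proof -
  assume pq: "- S \<le> p" "p < q" "q \<le> S"
  have "0 < flux q - flux p"
  proof (rule positive_integral[OF pq(2,1,3) flux_has_integral])
    show "0 < - Im \<kappa> * n1\<^sup>2" using n_sq Im_\<kappa> by (intro mult_pos_pos) auto
    show "- Im \<kappa> * n1\<^sup>2 * (norm (Y s))\<^sup>2
        \<le> - Im \<kappa> * (ctrl s * (norm (Y s))\<^sup>2 + (norm (d s))\<^sup>2 / (norm \<kappa>)\<^sup>2)" for s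
    proof -
      have "n1\<^sup>2 * (norm (Y s))\<^sup>2 \<le> ctrl s * (norm (Y s))\<^sup>2"
        using ctrl_bounds(1) by (intro mult_right_mono) auto
      moreover have "0 \<le> (norm (d s))\<^sup>2 / (norm \<kappa>)\<^sup>2" by simp
      ultimately have "n1\<^sup>2 * (norm (Y s))\<^sup>2 \<le> ctrl s * (norm (Y s))\<^sup>2 + (norm (d s))\<^sup>2 / (norm \<kappa>)\<^sup>2"
        by linarith
      then show ?thesis
        unfolding mult.assoc by (rule mult_left_mono) (use Im_\<kappa> in simp)
    qed
  qed (use pq in auto)
  then show ?thesis by simp
qed

section \<open>Transversal sign changes of the imaginary part of the squared profile\<close>

lemma im_sq_deriv: "(im_sq has_real_derivative 2 * Im (Y s * d s)) (at s)"
proof -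
  have "((\<lambda>s. Y s * Y s) has_vector_derivative (Y s * d s + d s * Y s)) (at s)"
    by (intro derivative_intros Y_deriv)
  from bounded_linear.has_vector_derivative[OF bounded_linear_Im this]
  show ?thesis
    by (simp add: im_sq_def[abs_def] power2_eq_square has_real_derivative_iff_has_vector_derivative algebra_simps)
qed

text \<open>
  At a zero of \<open>im_sq\<close> the number \<open>Y\<^sup>2\<close> is real, and \<open>im_sq\<close> increases there if \<open>Y\<^sup>2\<close> and the rotation have
  equal signs. Thus for a counterclockwise rotation layers of high index begin with \<open>Y\<^sup>2 > 0\<close> and end
  with \<open>Y\<^sup>2 < 0\<close>.
\<close>

lemma im_sq_deriv_at_zero:
  assumes "im_sq s = 0"
  shows "Im (Y s * d s) * (norm (Y s))\<^sup>2 = Re ((Y s)\<^sup>2) * rot s"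
proof -
  have "Y s * d s * of_real ((norm (Y s))\<^sup>2) = (Y s)\<^sup>2 * (d s * cnj (Y s))"
    by (simp only: complex_norm_square power2_eq_square[of "Y s"] mult_ac)
  then have "Im (Y s * d s * of_real ((norm (Y s))\<^sup>2)) = Im ((Y s)\<^sup>2 * (d s * cnj (Y s)))"
    by (simp only:)
  then show ?thesis using assms by (simp only: times_complex.sel Re_complex_of_real Im_complex_of_real rot_def im_sq_def mult_zero_right mult_zero_left add_0_right add_0_left)
qed

lemma Y_nz_if_rot: "rot s \<noteq> 0 \<Longrightarrow> Y s \<noteq> 0"
  by (auto simp: rot_def)

lemma Re_Y2_nz: "im_sq s = 0 \<Longrightarrow> Y s \<noteq> 0 \<Longrightarrow> Re ((Y s)\<^sup>2) \<noteq> 0"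
  by (metis im_sq_def complex_eqI zero_complex.sel power_eq_0_iff)

lemma switch_pointI:
  assumes "(eventually (\<lambda>t. im_sq t \<le> 0) (at_left s) \<and> eventually (\<lambda>t. 0 < im_sq t) (at_right s))
    \<or> (eventually (\<lambda>t. 0 < im_sq t) (at_left s) \<and> eventually (\<lambda>t. im_sq t \<le> 0) (at_right s))"
  shows "s \<in> switch_points n1 n2 Y"
proof -
  have lim: "eventually (\<lambda>t. im_sq t \<le> 0) F \<Longrightarrow> (ctrl \<longlongrightarrow> n1\<^sup>2) F"
    "eventually (\<lambda>t. 0 < im_sq t) F \<Longrightarrow> (ctrl \<longlongrightarrow> n2\<^sup>2) F" for F
    by (rule tendsto_eventually, erule eventually_mono, simp add: ctrl_eq)+
  have "\<exists>l r. l \<noteq> r \<and> (ctrl \<longlongrightarrow> l) (at_left s) \<and> (ctrl \<longlongrightarrow> r) (at_right s)"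
    using assms n_sq(2) lim by (metis less_irrefl)
  then show ?thesis
    by (simp add: switch_points_def ctrl_def[abs_def])
qed

lemma eventually_of_deriv:
  assumes "im_sq s = 0"
  shows "0 < Im (Y s * d s) \<Longrightarrow> eventually (\<lambda>t. im_sq t < 0) (at_left s) \<and> eventually (\<lambda>t. 0 < im_sq t) (at_right s)"
    and "Im (Y s * d s) < 0 \<Longrightarrow> eventually (\<lambda>t. 0 < im_sq t) (at_left s) \<and> eventually (\<lambda>t. im_sq t < 0) (at_right s)"
proof -
  have L: "eventually P (at_left s)" if "0 < (e :: real)" "\<And>h. 0 < h \<Longrightarrow> h < e \<Longrightarrow> P (s - h)" for P e
  proof (rule eventually_at_leftI[of "s - e"])
    show "P t" if "t \<in> {s - e<..<s}" for t using that \<open>\<And>h. 0 < h \<Longrightarrow> h < e \<Longrightarrow> P (s - h)\<close>[of "s - t"] by simp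
  qed (use that in simp)
  have R: "eventually P (at_right s)" if "0 < (e :: real)" "\<And>h. 0 < h \<Longrightarrow> h < e \<Longrightarrow> P (s + h)" for P e
  proof (rule eventually_at_rightI[of _ "s + e"])
    show "P t" if "t \<in> {s<..<s + e}" for t using that \<open>\<And>h. 0 < h \<Longrightarrow> h < e \<Longrightarrow> P (s + h)\<close>[of "t - s"] by simp
  qed (use that in simp)
  show "eventually (\<lambda>t. im_sq t < 0) (at_left s) \<and> eventually (\<lambda>t. 0 < im_sq t) (at_right s)" if "0 < Im (Y s * d s)"
    using DERIV_pos_inc_left[OF im_sq_deriv, of s] DERIV_pos_inc_right[OF im_sq_deriv, of s] that assms
    by (auto intro: L R)
  show "eventually (\<lambda>t. 0 < im_sq t) (at_left s) \<and> eventually (\<lambda>t. im_sq t < 0) (at_right s)" if "Im (Y s * d s) < 0"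
    using DERIV_neg_dec_left[OF im_sq_deriv, of s] DERIV_neg_dec_right[OF im_sq_deriv, of s] that assms
    by (auto intro: L R)
qed

lemma transversal_zero:
  assumes "im_sq s = 0" "rot s \<noteq> 0"
  shows "Im (Y s * d s) \<noteq> 0"
  using im_sq_deriv_at_zero[OF assms(1)] Re_Y2_nz[OF assms(1)] Y_nz_if_rot[OF assms(2)] assms(2)
  by (metis mult_zero_left no_zero_divisors)

lemma zero_is_switch:
  assumes "im_sq s = 0" "rot s \<noteq> 0"
  shows "s \<in> switch_points n1 n2 Y"
proof -
  have le: "eventually (\<lambda>t. im_sq t \<le> 0) F" if "eventually (\<lambda>t. im_sq t < 0) F" for F
    using that by eventually_elim simp
  show ?thesis
    using transversal_zero[OF assms] eventually_of_deriv[OF assms(1)] le[of "at_left s"] le[of "at_right s"]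
    by (intro switch_pointI) (metis linorder_neqE_linordered_idom)
qed

lemma rot_zero_unique: "s \<in> {- S..S} \<Longrightarrow> t \<in> {- S..S} \<Longrightarrow> rot s = 0 \<Longrightarrow> rot t = 0 \<Longrightarrow> s = t"
  using rot_strict_mono[of s t] rot_strict_mono[of t s] by (cases s t rule: linorder_cases) auto

section \<open>Symmetry\<close>

text \<open>
  The zeros of \<open>im_sq\<close> form a countable set: with at most one exception they are transversal, hence
  members of the switch sequence.
\<close>

lemma AE_eps_eq_ctrl: "AE s in lebesgue. s \<in> {- S..S} \<longrightarrow> \<epsilon> s = ctrl s"
proof -
  have "\<exists>t. {s \<in> {- S..S}. rot s = 0} \<subseteq> {t}"
    using rot_zero_unique by blast
  then have "countable {s \<in> {- S..S}. rot s = 0}"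
    by (meson countable_subset countable_insert countable_empty)
  moreover have "countable (switch_points n1 n2 Y)"
    using switches countable_image[of "UNIV :: int set" b] by (simp add: switch_sequence_def)
  ultimately have "countable ({s \<in> {- S..S}. rot s = 0} \<union> switch_points n1 n2 Y)"
    by (rule countable_Un)
  moreover have "{s \<in> {- S..S}. im_sq s = 0} \<subseteq> {s \<in> {- S..S}. rot s = 0} \<union> switch_points n1 n2 Y"
    using zero_is_switch by auto
  ultimately have "countable {s \<in> {- S..S}. im_sq s = 0}"
    by (rule countable_subset[rotated])
  then have "AE s in lebesgue. s \<notin> {s \<in> {- S..S}. im_sq s = 0}"
    by (intro AE_not_in) (rule null_sets_completionI[OF countable_imp_null_set_lborel])
  with eps_bang show ?thesis
    by eventually_elim (auto simp: ctrl_eq im_sq_def)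
qed

lemma AE_ctrl_even: "AE s in lebesgue. s \<in> {- S..S} \<longrightarrow> ctrl (- s) = ctrl s"
  using AE_eps_eq_ctrl AE_lebesgue_uminus[OF AE_eps_eq_ctrl] eps_even
  by eventually_elim auto

lemma Y_reflect_deriv: "((\<lambda>r. Y (- r)) has_vector_derivative - d (- r)) (at r)"
  using vector_diff_chain_at[of uminus "-1" r Y "d (- r)"] Y_deriv
  by (simp add: o_def has_vector_derivative_minus)

text \<open>
  The Wronskian of \<open>Y\<close> and its reflection is constant because the coefficient is even almost everywhere
  on \<open>[- S, S]\<close>, and it vanishes at \<open>S\<close> because both functions satisfy the same radiation condition
  there. At \<open>0\<close> it equals \<open>2 * Y 0 * d 0\<close>, so that both currents vanish at \<open>0\<close>.
\<close>

lemma wronskian_zero: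
  assumes s: "s \<in> {- S..S}"
  shows "Y (- s) * d s + d (- s) * Y s = 0"
proof -
  define w where "w s = d s * Y (- s) + d (- s) * Y s" for s
  have w_const: "w q = w p" if pq: "- S \<le> p" "p \<le> q" "q \<le> S" for p q
  proof -
    let ?F = "\<lambda>s. - \<kappa>\<^sup>2 * of_real (ctrl s) * Y s * Y (- s) + d s * - d (- s)"
    have cd: "continuous_on A (\<lambda>r. - d (- r))" for A
      by (intro continuous_intros continuous_on_compose2[OF continuous_on_d[of UNIV]]) auto
    have I1: "(?F has_integral (d q * Y (- q) - d p * Y (- p))) {p..q}"
      by (rule d_times_has_integral[OF pq(2) Y_reflect_deriv cd])
    have "(?F has_integral (d (- p) * Y p - d (- q) * Y q)) {- q..- p}"
      using d_times_has_integral[OF _ Y_reflect_deriv cd, of "- q" "- p"] pq by simp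
    then have I2: "((\<lambda>s. ?F (- s)) has_integral (d (- p) * Y p - d (- q) * Y q)) {p..q}"
      using has_integral_reflect_real[of ?F "d (- p) * Y p - d (- q) * Y q" "-p" "-q"] by simp
    have "d q * Y (- q) - d p * Y (- p) - (d (- p) * Y p - d (- q) * Y q) = w q - w p"
      by (simp add: w_def)
    with has_integral_diff[OF I1 I2]
    have D1: "((\<lambda>s. ?F s - ?F (- s)) has_integral (w q - w p)) {p..q}"
      by (simp only:)
    have D2: "((\<lambda>s. ?F s - ?F (- s)) has_integral 0) {p..q}"
    proof (rule has_integral_negligible)
      show "negligible {s. \<not> (s \<in> {- S..S} \<longrightarrow> ctrl (- s) = ctrl s)}"
        using AE_ctrl_even by (simp only: AE_lebesgue_iff_negligible)
      show "?F s - ?F (- s) = 0" if "s \<in> {p..q} - {s. \<not> (s \<in> {- S..S} \<longrightarrow> ctrl (- s) = ctrl s)}" for s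
      proof -
        have "ctrl (- s) = ctrl s" using that pq by auto
        then show ?thesis by (simp add: mult_ac)
      qed
    qed
    show ?thesis using has_integral_unique[OF D1 D2] by simp
  qed
  have "w s = w S" using w_const[of s S] s by auto
  also have "w S = 0" by (simp add: w_def radiation_right radiation_left)
  finally show ?thesis by (simp add: w_def mult.commute)
qed

lemma Y0_or_d0: "Y 0 = 0 \<or> d 0 = 0"
  using wronskian_zero[of 0] S_pos by simp

lemma rot_0: "rot 0 = 0" and flux_0: "flux 0 = 0"
  using Y0_or_d0 by (auto simp: rot_def flux_def)

lemma rot_pos: "0 < s \<Longrightarrow> s \<le> S \<Longrightarrow> 0 < rot s"
  using rot_strict_mono[of 0 s] rot_0 S_pos by simp

lemma rot_neg: "s < 0 \<Longrightarrow> - S \<le> s \<Longrightarrow> rot s < 0"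
  using rot_strict_mono[of s 0] rot_0 S_pos by simp

lemma flux_pos: "0 < s \<Longrightarrow> s \<le> S \<Longrightarrow> 0 < flux s"
  using flux_strict_mono[of 0 s] flux_0 S_pos by simp

lemma Y_nz: "s \<in> {- S..S} \<Longrightarrow> s \<noteq> 0 \<Longrightarrow> Y s \<noteq> 0"
  using rot_pos[of s] rot_neg[of s] by (intro Y_nz_if_rot) (cases "0 < s"; auto)

text \<open>
  The vanishing Wronskian makes \<open>Y (- s) = k * Y s\<close> on \<open>(0, S]\<close>; matching at \<open>0\<close> leaves \<open>k = 1\<close> or \<open>k = - 1\<close>,
  and \<open>k\<close> disappears in the square.
\<close>

lemma im_sq_even:
  assumes "s \<in> {- S..S}"
  shows "im_sq (- s) = im_sq s"
proof -
  let ?Q = "\<lambda>s. Y (- s) / Y s"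
  have "(?Q has_derivative (\<lambda>h. 0)) (at s within {0<..S})" if s: "s \<in> {0<..S}" for s
  proof -
    have Yd: "(Y has_derivative (\<lambda>h. of_real h * d s)) (at s within {0<..S})" for s
      using has_vector_derivative_at_within[OF Y_deriv] 
      by (simp add: has_vector_derivative_def scaleR_conv_of_real)
    have "((\<lambda>s. Y (- s)) has_vector_derivative - d (- s)) (at s within {0<..S})"
      by (rule has_vector_derivative_at_within[OF Y_reflect_deriv])
    then have Ym: "((\<lambda>s. Y (- s)) has_derivative (\<lambda>h. of_real h * - d (- s))) (at s within {0<..S})"
      by (simp add: has_vector_derivative_def scaleR_conv_of_real)
    have nz: "Y s \<noteq> 0" using Y_nz[of s] s by auto
    have "(of_real h * - d (- s) * Y s - Y (- s) * (of_real h * d s)) / (Y s * Y s) = 0" for h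
    proof -
      have "of_real h * - d (- s) * Y s - Y (- s) * (of_real h * d s)
          = - of_real h * (Y (- s) * d s + d (- s) * Y s)" by (simp add: algebra_simps)
      then show ?thesis using wronskian_zero[of s] s by simp
    qed
    with has_derivative_divide'[OF Ym Yd nz] show ?thesis by (simp only:)
  qed
  then have "\<exists>k. \<forall>s\<in>{0<..S}. ?Q s = k"
    by (intro has_derivative_zero_constant) auto
  then obtain k where k: "\<And>s. s \<in> {0<..S} \<Longrightarrow> ?Q s = k" by blast
  have Yk: "Y (- s) = k * Y s" and dk: "d (- s) = - k * d s" if s: "s \<in> {0<..S}" for s
  proof -
    have nz: "Y s \<noteq> 0" using Y_nz[of s] s by auto
    then show 1: "Y (- s) = k * Y s" using k[OF s] by (simp add: field_simps)
    have "(d (- s) + k * d s) * Y s = 0"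
      using wronskian_zero[of s] s 1 by (simp add: algebra_simps)
    then show "d (- s) = - k * d s" using nz by (simp add: eq_neg_iff_add_eq_0)
  qed
  have at0: "F 0 = G 0" if "continuous_on UNIV F" "continuous_on UNIV G" "\<And>s. s \<in> {0<..S} \<Longrightarrow> F s = G s"
    for F G :: "real \<Rightarrow> complex"
  proof -
    have "closure {0<..S} \<subseteq> {s. F s = G s}"
      using that by (intro closure_minimal closed_Collect_eq) auto
    then have "0 \<in> {s. F s = G s}"
      by (rule subsetD) (use S_pos in \<open>simp add: closure_greaterThanAtMost\<close>)
    then show ?thesis by simp
  qed
  have cu: "continuous_on UNIV (\<lambda>s. F (- s))" if "continuous_on UNIV F" for F :: "real \<Rightarrow> complex"
    by (rule continuous_on_compose2[OF that]) (auto intro!: continuous_intros)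
  \<comment> \<open>By continuity both relations persist at \<open>0\<close>, where \<open>Y\<close> and \<open>d\<close> do not both vanish.\<close>
  have "Y 0 = k * Y 0" "d 0 = - k * d 0"
    using at0[OF cu[OF continuous_on_Y] continuous_on_mult_left[OF continuous_on_Y] Yk]
      at0[OF cu[OF continuous_on_d] continuous_on_mult_left[OF continuous_on_d] dk] by simp_all
  moreover have "Y 0 \<noteq> 0 \<or> d 0 \<noteq> 0"
    using energy[of 0] S_pos lam_pos by (auto simp: im_sq_def)
  ultimately have "k = 1 \<or> - k = 1" by (metis mult_cancel_right1)
  then have k2: "k\<^sup>2 = 1" by (auto simp: power2_eq_1_iff minus_equation_iff)
  have pos: "im_sq (- s) = im_sq s" if "s \<in> {0<..S}" for s
    using Yk[OF that] k2 by (simp add: im_sq_def power_mult_distrib)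
  show ?thesis
    using pos[of s] pos[of "- s"] assms by (cases s "0 :: real" rule: linorder_cases) auto
qed

section \<open>Switch points inside the interval\<close>

abbreviation Sw :: "real set" where "Sw \<equiv> switch_points n1 n2 Y"

lemma ctrl_tendsto_unless_zero:
  assumes "im_sq s \<noteq> 0"
  shows "(ctrl \<longlongrightarrow> ctrl s) (at s within A)"
proof -
  have cont: "isCont im_sq s" using continuous_on_im_sq[of UNIV] by (simp add: continuous_on_eq_continuous_at)
  then have t: "(im_sq \<longlongrightarrow> im_sq s) (at s within A)"
    using continuous_at_imp_continuous_at_within continuous_within by blast
  have "eventually (\<lambda>t. ctrl t = ctrl s) (at s within A)"
  proof (cases "0 < im_sq s")
    case True
    from order_tendstoD(1)[OF t True] show ?thesis by eventually_elim (simp add: ctrl_eq True)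
  next
    case False
    with assms have "im_sq s < 0" by simp
    from order_tendstoD(2)[OF t this] show ?thesis 
      by eventually_elim (use \<open>im_sq s < 0\<close> in \<open>simp add: ctrl_eq\<close>)
  qed
  then show ?thesis by (rule tendsto_eventually)
qed

lemma switch_is_zero:
  assumes "s \<in> Sw"
  shows "im_sq s = 0"
proof (rule ccontr)
  assume nz: "im_sq s \<noteq> 0"
  obtain l r where lr: "l \<noteq> r" "(ctrl \<longlongrightarrow> l) (at_left s)" "(ctrl \<longlongrightarrow> r) (at_right s)"
    using assms by (auto simp: switch_points_def ctrl_def[abs_def])
  have "l = ctrl s" by (rule tendsto_unique[OF _ lr(2) ctrl_tendsto_unless_zero[OF nz]]) simp
  moreover have "r = ctrl s" by (rule tendsto_unique[OF _ lr(3) ctrl_tendsto_unless_zero[OF nz]]) simp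
  ultimately show False using lr(1) by simp
qed

text \<open>
  The control is even near \<open>0\<close>, so its one-sided limits at \<open>0\<close> coincide, even when \<open>im_sq\<close> vanishes there.
\<close>

lemma zero_not_switch: "0 \<notin> Sw"
proof
  assume "0 \<in> Sw"
  then obtain l r where lr: "l \<noteq> r" "(ctrl \<longlongrightarrow> l) (at_left 0)" "(ctrl \<longlongrightarrow> r) (at_right 0)"
    by (auto simp: switch_points_def ctrl_def[abs_def])
  have "((\<lambda>s. ctrl (- s)) \<longlongrightarrow> l) (at_right 0)"
    using lr(2) by (simp add: filterlim_at_left_to_right)
  moreover have "eventually (\<lambda>s. ctrl (- s) = ctrl s) (at_right 0)"
    by (rule eventually_at_rightI[of _ S]) (use S_pos in \<open>auto simp: ctrl_eq im_sq_even\<close>)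
  ultimately have l: "(ctrl \<longlongrightarrow> l) (at_right 0)"
    by (rule Lim_transform_eventually)
  have "l = r" by (rule tendsto_unique[OF _ l lr(3)]) simp
  then show False using lr(1) by simp
qed

text \<open>
  The radiation condition gives \<open>(d S)\<^sup>2 / \<kappa>\<^sup>2 = - ninf\<^sup>2 * (Y S)\<^sup>2\<close>. The sign of \<open>lam\<close> then decides the index of
  the edge layers: \<open>im_sq S\<close> is positive only if \<open>ninf\<^sup>2 < n2\<^sup>2\<close>, and negative only if \<open>ninf\<^sup>2 > n1\<^sup>2\<close>.
\<close>

lemma edge_energy: "(ctrl S - ninf\<^sup>2) * im_sq S = lam"
proof -
  have "(d S)\<^sup>2 / \<kappa>\<^sup>2 = - of_real (ninf\<^sup>2) * (Y S)\<^sup>2"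
    using \<kappa>_nz by (simp add: radiation_right power_mult_distrib)
  then show ?thesis using energy[of S] S_pos by (simp add: im_sq_def algebra_simps)
qed

lemma switch_iff:
  assumes "s \<in> {- S..S}"
  shows "s \<in> Sw \<longleftrightarrow> s \<noteq> 0 \<and> im_sq s = 0"
  using assms rot_pos[of s] rot_neg[of s] zero_is_switch[of s] switch_is_zero[of s] zero_not_switch
  by (cases s "0 :: real" rule: linorder_cases) auto

lemma S_not_switch: "S \<notin> Sw" "- S \<notin> Sw"
  using switch_is_zero[of S] switch_is_zero[of "- S"] edge_energy lam_pos im_sq_even[of S] S_pos by auto

lemma switch_uminus: "s \<in> {- S..S} \<Longrightarrow> - s \<in> Sw \<longleftrightarrow> s \<in> Sw"
  by (auto simp: switch_iff im_sq_even)

lemma im_sq_sign_const: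
  assumes "\<And>s. s \<in> {p<..<q} \<Longrightarrow> im_sq s \<noteq> 0"
  shows "(\<forall>s\<in>{p<..<q}. 0 < im_sq s) \<or> (\<forall>s\<in>{p<..<q}. im_sq s < 0)"
proof (rule ccontr)
  assume "\<not> ?thesis"
  then obtain s t where st: "s \<in> {p<..<q}" "t \<in> {p<..<q}" "im_sq s < 0" "0 < im_sq t"
    using assms by (metis linorder_neqE_linordered_idom)
  have "connected (im_sq ` {p<..<q})"
    by (intro connected_continuous_image continuous_on_im_sq) simp
  then have "0 \<in> im_sq ` {p<..<q}"
    using st by (auto simp: connected_iff_interval)
  then show False using assms by auto
qed

section \<open>The profile on a layer and the impedance at a switch point\<close>

lemma layer_formula:
  assumes n: "0 < n" and pq: "p < q" and cn: "\<forall>s\<in>{p<..<q}. ctrl s = n\<^sup>2" and s: "s \<in> {p..q}"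
  shows "Y s = Y p * cos (\<kappa> * of_real (n * (s - p))) + d p / (\<kappa> * of_real n) * sin (\<kappa> * of_real (n * (s - p)))"
proof -
  let ?a = "\<kappa> * of_real n"
  let ?C = "\<lambda>s. cos (?a * of_real (s - p))" and ?Sn = "\<lambda>s. sin (?a * of_real (s - p))"
  let ?f = "\<lambda>s. - (?a\<^sup>2) * Y s"
  have a: "?a \<noteq> 0" using \<kappa>_nz n by simp
  have int: "(?f has_integral (d t - d p)) {p..t}" if t: "t \<in> {p..q}" for t
  proof (rule has_integral_spike_finite[OF _ _ d_integral'[of p t]])
    show "finite {p, q}" by simp
    show "?f x = - \<kappa>\<^sup>2 * of_real (ctrl x) * Y x" if "x \<in> {p..t} - {p, q}" for x
      using that t bspec[OF cn, of x] by (simp add: power_mult_distrib)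
  qed (use t in auto)
  have cf: "continuous_on {p..q} ?f"
    by (intro continuous_intros continuous_on_Y)
  have dd: "(d has_vector_derivative ?f t) (at t within {p..q})" if t: "t \<in> {p..q}" for t
  proof (rule has_vector_derivative_transform[OF t])
    show "((\<lambda>u. integral {p..u} ?f + d p) has_vector_derivative ?f t) (at t within {p..q})"
      by (intro has_vector_derivative_add_const[THEN iffD2] integral_has_vector_derivative[OF cf t])
    show "d u = integral {p..u} ?f + d p" if "u \<in> {p..q}" for u
      using integral_unique[OF int[OF that]] by (simp only: diff_add_cancel)
  qed
  have dY: "(Y has_vector_derivative d t) (at t within A)" for t A
    by (rule has_vector_derivative_at_within[OF Y_deriv])
  have dC: "(?C has_vector_derivative - ?a * ?Sn t) (at t within A)" for t A
  proof -
    have "((\<lambda>z. cos (?a * (z - of_real p))) has_field_derivative - ?a * sin (?a * (of_real t - of_real p))) (at (of_real t))"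
      by (auto intro!: derivative_eq_intros)
    from has_vector_derivative_real_field[OF this] show ?thesis by simp
  qed
  have dSn: "(?Sn has_vector_derivative ?a * ?C t) (at t within A)" for t A
  proof -
    have "((\<lambda>z. sin (?a * (z - of_real p))) has_field_derivative ?a * cos (?a * (of_real t - of_real p))) (at (of_real t))"
      by (auto intro!: derivative_eq_intros)
    from has_vector_derivative_real_field[OF this] show ?thesis by simp
  qed
  \<comment> \<open>The values of \<open>Y\<close> and \<open>d / a\<close> rotated back to \<open>p\<close> are first integrals of \<open>Y'' = - a\<^sup>2 Y\<close>.\<close>
  have "\<exists>k. \<forall>t\<in>{p..q}. Y t * ?C t - d t * ?Sn t / ?a = k"
  proof (rule has_derivative_zero_constant)
    fix t assume t: "t \<in> {p..q}"
    have "((\<lambda>t. Y t * ?C t - d t * ?Sn t / ?a) has_vector_derivative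
       (Y t * (- ?a * ?Sn t) + d t * ?C t - (d t * (?a * ?C t) + ?f t * ?Sn t) / ?a)) (at t within {p..q})"
      by (intro has_vector_derivative_diff has_vector_derivative_mult has_vector_derivative_divide dY dC dSn dd t)
    moreover have "Y t * (- ?a * ?Sn t) + d t * ?C t - (d t * (?a * ?C t) + ?f t * ?Sn t) / ?a = 0"
      using a by (simp add: field_simps power2_eq_square)
    ultimately show "((\<lambda>t. Y t * ?C t - d t * ?Sn t / ?a) has_derivative (\<lambda>h. 0)) (at t within {p..q})"
      by (simp add: has_vector_derivative_def)
  qed simp
  then obtain k where k: "\<forall>t\<in>{p..q}. Y t * ?C t - d t * ?Sn t / ?a = k" by blast
  have 1: "Y s * ?C s - d s * ?Sn s / ?a = Y p"
    using bspec[OF k s] bspec[OF k, of p] pq by simp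
  have "\<exists>k. \<forall>t\<in>{p..q}. Y t * ?Sn t + d t * ?C t / ?a = k"
  proof (rule has_derivative_zero_constant)
    fix t assume t: "t \<in> {p..q}"
    have "((\<lambda>t. Y t * ?Sn t + d t * ?C t / ?a) has_vector_derivative
       (Y t * (?a * ?C t) + d t * ?Sn t + (d t * (- ?a * ?Sn t) + ?f t * ?C t) / ?a)) (at t within {p..q})"
      by (intro has_vector_derivative_add has_vector_derivative_mult has_vector_derivative_divide dY dC dSn dd t)
    moreover have "Y t * (?a * ?C t) + d t * ?Sn t + (d t * (- ?a * ?Sn t) + ?f t * ?C t) / ?a = 0"
      using a by (simp add: field_simps power2_eq_square)
    ultimately show "((\<lambda>t. Y t * ?Sn t + d t * ?C t / ?a) has_derivative (\<lambda>h. 0)) (at t within {p..q})"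
      by (simp add: has_vector_derivative_def)
  qed simp
  then obtain l where l: "\<forall>t\<in>{p..q}. Y t * ?Sn t + d t * ?C t / ?a = l" by blast
  have 2: "Y s * ?Sn s + d s * ?C s / ?a = d p / ?a"
    using bspec[OF l s] bspec[OF l, of p] pq by simp
  have "(y * C - D * T / ?a) * C + (y * T + D * C / ?a) * T = y * (T\<^sup>2 + C\<^sup>2)" for y C D T
    using a by (simp add: field_simps power2_eq_square)
  from this[of "Y s" "?C s" "d s" "?Sn s"] have "Y p * ?C s + d p / ?a * ?Sn s = Y s"
    unfolding 1 2 sin_cos_squared_add by simp
  then show ?thesis by (simp add: mult.assoc)
qed

lemma zero_followed_by_sign:
  assumes p: "0 < p" "p \<le> S" "im_sq p = 0" and pq: "p < q"
  shows "(\<And>s. s \<in> {p<..<q} \<Longrightarrow> 0 < im_sq s) \<Longrightarrow> 0 < Re ((Y p)\<^sup>2)"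
    and "(\<And>s. s \<in> {p<..<q} \<Longrightarrow> im_sq s < 0) \<Longrightarrow> Re ((Y p)\<^sup>2) < 0"
proof -
  have Re_nz: "Re ((Y p)\<^sup>2) \<noteq> 0" using Re_Y2_nz[OF p(3)] Y_nz[of p] p by auto
  have N: "0 < (norm (Y p))\<^sup>2" using Y_nz[of p] p by auto
  note sgn = im_sq_deriv_at_zero[OF p(3)]
  show "0 < Re ((Y p)\<^sup>2)" if pos: "\<And>s. s \<in> {p<..<q} \<Longrightarrow> 0 < im_sq s"
  proof (rule ccontr)
    assume "\<not> ?thesis"
    then have "Re ((Y p)\<^sup>2) * rot p < 0" using Re_nz rot_pos[of p] p by (simp add: mult_less_0_iff)
    then have "Im (Y p * d p) < 0" using sgn N by (metis mult_less_0_iff not_less_iff_gr_or_eq)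
    then have "eventually (\<lambda>t. im_sq t < 0) (at_right p)" using eventually_of_deriv(2)[OF p(3)] by blast
    moreover have "eventually (\<lambda>t. 0 < im_sq t) (at_right p)"
      by (rule eventually_at_rightI[of _ q]) (use pos pq in auto)
    ultimately have "eventually (\<lambda>t. False) (at_right p)" by eventually_elim simp
    then show False by simp
  qed
  show "Re ((Y p)\<^sup>2) < 0" if neg: "\<And>s. s \<in> {p<..<q} \<Longrightarrow> im_sq s < 0"
  proof (rule ccontr)
    assume "\<not> ?thesis"
    then have "0 < Re ((Y p)\<^sup>2) * rot p" using Re_nz rot_pos[of p] p by simp
    then have "0 < Im (Y p * d p)" using sgn N by (metis zero_less_mult_pos2)
    then have "eventually (\<lambda>t. 0 < im_sq t) (at_right p)" using eventually_of_deriv(1)[OF p(3)] by blast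
    moreover have "eventually (\<lambda>t. im_sq t < 0) (at_right p)"
      by (rule eventually_at_rightI[of _ q]) (use neg pq in auto)
    ultimately have "eventually (\<lambda>t. False) (at_right p)" by eventually_elim simp
    then show False by simp
  qed
qed

lemma zero_preceded_by_pos:
  assumes q: "0 < q" "q \<le> S" "im_sq q = 0" and pq: "p < q"
    and pos: "\<And>s. s \<in> {p<..<q} \<Longrightarrow> 0 < im_sq s"
  shows "Re ((Y q)\<^sup>2) < 0"
proof (rule ccontr)
  have Re_nz: "Re ((Y q)\<^sup>2) \<noteq> 0" using Re_Y2_nz[OF q(3)] Y_nz[of q] q by auto
  have N: "0 < (norm (Y q))\<^sup>2" using Y_nz[of q] q by auto
  assume "\<not> ?thesis"
  then have "0 < Re ((Y q)\<^sup>2) * rot q" using Re_nz rot_pos[of q] q by simp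
  then have "0 < Im (Y q * d q)" using im_sq_deriv_at_zero[OF q(3)] N by (metis zero_less_mult_pos2)
  then have "eventually (\<lambda>t. im_sq t < 0) (at_left q)" using eventually_of_deriv(1)[OF q(3)] by blast
  moreover have "eventually (\<lambda>t. 0 < im_sq t) (at_left q)"
    by (rule eventually_at_leftI[of p]) (use pos pq in auto)
  ultimately have "eventually (\<lambda>t. False) (at_left q)" by eventually_elim simp
  then show False by simp
qed

text \<open>
  \<open>X\<close> is the value \<open>x p\<close>. Positivity of the flux gives the sign of \<open>Re X\<close>. As \<open>(Y p)\<^sup>2\<close> is real, the energy
  identity reads \<open>- (Y p)\<^sup>2 * Im (X\<^sup>2) = lam\<close>, which gives the sign of \<open>Im X\<close>.
\<close>

lemma impedance_at_zero:
  assumes p: "0 < p" "p \<le> S" "im_sq p = 0"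
  obtains X where "d p = \<i> * \<kappa> * X * Y p" "0 < Re X" "Re ((Y p)\<^sup>2) * Im X < 0"
proof
  let ?X = "d p / (\<i> * \<kappa> * Y p)"
  have nz: "Y p \<noteq> 0" using Y_nz[of p] p by auto
  show dX: "d p = \<i> * \<kappa> * ?X * Y p" using nz \<kappa>_nz by simp
  have "d p * cnj (Y p) / (\<i> * \<kappa>) = ?X * (Y p * cnj (Y p))"
    using nz \<kappa>_nz by (simp add: field_simps)
  then have "flux p = Re ?X * (norm (Y p))\<^sup>2"
    by (simp only: flux_def complex_norm_square[symmetric] times_complex.sel
        Re_complex_of_real Im_complex_of_real mult_zero_right diff_0_right)
  then show ReX: "0 < Re ?X"
    using flux_pos[OF p(1,2)] by (metis zero_less_mult_pos2 zero_less_norm_iff zero_less_power nz)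
  have "(d p)\<^sup>2 / \<kappa>\<^sup>2 = - (?X\<^sup>2 * (Y p)\<^sup>2)"
    using nz \<kappa>_nz by (simp add: field_simps power_mult_distrib power_divide)
  then have "- Im (?X\<^sup>2 * (Y p)\<^sup>2) = lam" using energy[of p] p by simp
  moreover have "Im (X\<^sup>2 * Z) = 2 * Re X * (Re Z * Im X)" if "Im Z = 0" for X Z
    using that by (simp add: power2_eq_square)
  from this[OF p(3)[unfolded im_sq_def]]
  have "Im (?X\<^sup>2 * (Y p)\<^sup>2) = 2 * Re ?X * (Re ((Y p)\<^sup>2) * Im ?X)" .
  ultimately have "2 * Re ?X * (Re ((Y p)\<^sup>2) * Im ?X) < 0" using lam_pos by linarith
  then show "Re ((Y p)\<^sup>2) * Im ?X < 0" using ReX by (simp add: mult_less_0_iff)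
qed

end

section \<open>Lengths of layers\<close>

lemma Re_cos_plus_sin:
  fixes w r xi eta :: real
  shows "Re (cos (Complex w (- r)) + \<i> * Complex xi eta * sin (Complex w (- r)))
    = cos w * (cosh r + xi * sinh r) - eta * (sin w * cosh r)"
  by (simp add: Re_cos Re_sin Im_sin cosh_def sinh_def field_simps)

lemma Im_mult_of_real: "Im (z * of_real a) = Im z * a"
  by simp

lemma complex_mult_real: "\<kappa> * of_real t = Complex (Re \<kappa> * t) (Im \<kappa> * t)"
  by (simp add: complex_eq_iff)

text \<open>
  Squares of cosine and sine are real after a quarter and a half period of the real part of the
  argument, whatever the imaginary part is.
\<close>

lemma cos_squared_at_quarter: "(cos (Complex (pi / 2) r))\<^sup>2 = - of_real ((sinh r)\<^sup>2)"
  by (simp add: complex_eq_iff Re_cos Im_cos Re_sin Im_sin sinh_def power2_eq_square field_simps)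

lemma sin_squared_at_quarter: "(sin (Complex (pi / 2) r))\<^sup>2 = of_real ((cosh r)\<^sup>2)"
  by (simp add: complex_eq_iff Re_cos Im_cos Re_sin Im_sin cosh_def power2_eq_square field_simps)

lemma sin_squared_at_half: "(sin (Complex pi r))\<^sup>2 = - of_real ((sinh r)\<^sup>2)"
  by (simp add: complex_eq_iff Re_cos Im_cos Re_sin Im_sin sinh_def power2_eq_square field_simps)

text \<open>
  Used for quotients of two values of \<open>Y\<close> whose squares are real and of opposite signs.
\<close>

lemma Re_zero_if_square_neg:
  assumes "Im (z\<^sup>2) = 0" "Re (z\<^sup>2) < 0"
  shows "Re z = 0"
proof (rule ccontr)
  assume "Re z \<noteq> 0"
  with assms(1) have "Im z = 0" by (simp add: power2_eq_square)
  with assms(2) show False by (simp add: power2_eq_square mult_less_0_iff)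
qed

context extremal_profile
begin

text \<open>
  \<open>\<kappa> n L = phase n L - \<i> growth n L\<close>: an outgoing wave turns by \<open>phase n L\<close> along a stretch of length \<open>L\<close>
  and index \<open>n\<close>, while its modulus is multiplied by \<open>exp (growth n L)\<close>.
\<close>

definition phase :: "real \<Rightarrow> real \<Rightarrow> real" where "phase n L = Re \<kappa> * (n * L)"

definition growth :: "real \<Rightarrow> real \<Rightarrow> real" where "growth n L = - Im \<kappa> * (n * L)"

lemma kappa_times: "\<kappa> * of_real (n * L) = Complex (phase n L) (- growth n L)"
  by (simp only: complex_mult_real phase_def growth_def mult_minus_left minus_minus)

lemma growth_pos: "0 < n \<Longrightarrow> 0 < L \<Longrightarrow> 0 < growth n L"
  using Im_\<kappa> by (simp add: growth_def mult_less_0_iff)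

lemma relative_profile:
  assumes n: "0 < n" and pq: "p < q" and cn: "\<forall>s\<in>{p<..<q}. ctrl s = n\<^sup>2" and s: "s \<in> {p..q}"
    and dp: "d p = \<i> * \<kappa> * X * Y p" and Yp: "Y p \<noteq> 0"
  shows "Re (Y s / Y p) = cos (phase n (s - p)) * (cosh (growth n (s - p)) + Re X / n * sinh (growth n (s - p)))
     - Im X / n * (sin (phase n (s - p)) * cosh (growth n (s - p)))"
proof -
  have "Y s / Y p = cos (\<kappa> * of_real (n * (s - p))) + \<i> * (X / of_real n) * sin (\<kappa> * of_real (n * (s - p)))"
    unfolding layer_formula[OF n pq cn s] dp using Yp n \<kappa>_nz
    by (simp add: add_divide_distrib)
  also have "X / of_real n = Complex (Re X / n) (Im X / n)"
    by (simp add: complex_eq_iff)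
  finally show ?thesis
    by (simp only: kappa_times Re_cos_plus_sin)
qed

text \<open>
  If \<open>Y s / Y p\<close> is imaginary, then \<open>(Y s)\<^sup>2\<close> is a real multiple of the real number \<open>(Y p)\<^sup>2\<close>.
\<close>

lemma zero_if_relative_Re_zero:
  assumes "im_sq p = 0" "Y p \<noteq> 0" "Re (Y s / Y p) = 0"
  shows "im_sq s = 0"
proof -
  have "Y s / Y p = \<i> * of_real (Im (Y s / Y p))" using assms(3) by (simp add: complex_eq_iff)
  then have "(Y s)\<^sup>2 = - of_real ((Im (Y s / Y p))\<^sup>2) * (Y p)\<^sup>2"
    using assms(2) by (metis mult_minus1 nonzero_divide_eq_eq of_real_power power2_i power_mult_distrib)
  then show ?thesis using assms(1) by (simp add: im_sq_def)
qed

text \<open>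
  The relative profile \<open>Y s / Y p\<close> equals \<open>1\<close> at \<open>p\<close>. If its real part becomes negative within distance \<open>L\<close>,
  it has a zero before that, and there the layer ends.
\<close>

lemma length_less_if_relative_negative:
  assumes p: "im_sq p = 0" "Y p \<noteq> 0" and L: "0 < L" and nz: "\<And>s. s \<in> {p<..<q} \<Longrightarrow> im_sq s \<noteq> 0"
    and neg: "p + L \<le> q \<Longrightarrow> Re (Y (p + L) / Y p) < 0"
  shows "q - p < L"
proof (rule ccontr)
  assume "\<not> ?thesis"
  then have le: "p + L \<le> q" by simp
  have "\<exists>s\<ge>p. s \<le> p + L \<and> Re (Y s / Y p) = 0"
    by (rule IVT2') (use p L neg[OF le] in \<open>auto intro!: continuous_intros continuous_on_Y\<close>)
  then obtain s where s: "p \<le> s" "s \<le> p + L" "Re (Y s / Y p) = 0" by blast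
  have "s \<noteq> p" "s \<noteq> p + L" using s(3) neg[OF le] p by auto
  then have "s \<in> {p<..<q}" using s le by auto
  then show False using nz zero_if_relative_Re_zero[OF p s(3)] by blast
qed

lemma n2_pos: "0 < n2" using n1_pos n1_less_n2 by simp

text \<open>
  Here \<open>(Y p)\<^sup>2 < 0\<close>, so \<open>Im X > 0\<close>, and after a phase of \<open>pi / 2\<close> only the negative term
  \<open>- (Im X / n1) * cosh r\<close> of the relative profile is left.
\<close>

lemma layer_low_index:
  assumes p: "0 < p" "p < q" "q \<le> S" "im_sq p = 0" and neg: "\<And>s. s \<in> {p<..<q} \<Longrightarrow> im_sq s < 0"
  shows "q - p < pi / (2 * n1 * Re \<kappa>)"
proof -
  obtain X where X: "d p = \<i> * \<kappa> * X * Y p" "0 < Re X" "Re ((Y p)\<^sup>2) * Im X < 0"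
    by (rule impedance_at_zero[of p]) (use p in auto)
  have "Re ((Y p)\<^sup>2) < 0" by (rule zero_followed_by_sign(2)[of p q]) (use p neg in auto)
  then have ImX: "0 < Im X" using X(3) by (simp add: mult_less_0_iff)
  have Yp: "Y p \<noteq> 0" using Y_nz[of p] p by auto
  have cn: "\<forall>s\<in>{p<..<q}. ctrl s = n1\<^sup>2" using neg by (force simp: ctrl_eq)
  let ?L = "pi / (2 * n1 * Re \<kappa>)"
  have ph: "phase n1 ?L = pi / 2" using n1_pos Re_\<kappa> by (simp add: phase_def)
  show ?thesis
  proof (rule length_less_if_relative_negative[OF p(4) Yp])
    show "0 < ?L" using n1_pos Re_\<kappa> by simp
    show "im_sq s \<noteq> 0" if "s \<in> {p<..<q}" for s using neg[OF that] by simp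
    assume "p + ?L \<le> q"
    then have "p + ?L \<in> {p..q}" using \<open>0 < ?L\<close> by simp
    from relative_profile[OF n1_pos p(2) cn this X(1) Yp]
    have "Re (Y (p + ?L) / Y p) = - (Im X / n1 * cosh (growth n1 ?L))"
      by (simp only: add_diff_cancel_left' ph sin_pi_half cos_pi_half mult_zero_left mult_1_left diff_0)
    also have "\<dots> < 0" using ImX n1_pos by (simp add: cosh_real_pos)
    finally show "Re (Y (p + ?L) / Y p) < 0" .
  qed
qed

text \<open>
  After a phase of \<open>pi\<close> only the term with \<open>cos pi = - 1\<close> is left, and it is negative as \<open>Re X > 0\<close>.
\<close>

lemma layer_high_index_upper:
  assumes p: "0 < p" "p < q" "q \<le> S" "im_sq p = 0" and pos: "\<And>s. s \<in> {p<..<q} \<Longrightarrow> 0 < im_sq s"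
  shows "q - p < pi / (n2 * Re \<kappa>)"
proof -
  obtain X where X: "d p = \<i> * \<kappa> * X * Y p" "0 < Re X" "Re ((Y p)\<^sup>2) * Im X < 0"
    by (rule impedance_at_zero[of p]) (use p in auto)
  have Yp: "Y p \<noteq> 0" using Y_nz[of p] p by auto
  have cn: "\<forall>s\<in>{p<..<q}. ctrl s = n2\<^sup>2" using pos by (force simp: ctrl_eq)
  let ?L = "pi / (n2 * Re \<kappa>)"
  have ph: "phase n2 ?L = pi" using n2_pos Re_\<kappa> by (simp add: phase_def)
  show ?thesis
  proof (rule length_less_if_relative_negative[OF p(4) Yp])
    show L: "0 < ?L" using n2_pos Re_\<kappa> by simp
    show "im_sq s \<noteq> 0" if "s \<in> {p<..<q}" for s using pos[OF that] by simp
    assume "p + ?L \<le> q"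
    then have "p + ?L \<in> {p..q}" using L by simp
    from relative_profile[OF n2_pos p(2) cn this X(1) Yp]
    have "Re (Y (p + ?L) / Y p) = - (cosh (growth n2 ?L) + Re X / n2 * sinh (growth n2 ?L))"
      by (simp only: add_diff_cancel_left' ph sin_pi cos_pi mult_zero_left mult_zero_right mult_minus1 diff_0_right)
    also have "\<dots> < 0" 
      using X(2) n2_pos growth_pos[OF n2_pos L]
      by (simp only: neg_less_0_iff_less) (intro add_pos_pos mult_pos_pos divide_pos_pos cosh_real_pos; simp)
    finally show "Re (Y (p + ?L) / Y p) < 0" .
  qed
qed

text \<open>
  Here \<open>(Y p)\<^sup>2 > 0 > (Y q)\<^sup>2\<close>, so the relative profile is imaginary at \<open>q\<close>; but since \<open>Im X < 0\<close>, both terms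
  of its real part are nonnegative and one is positive up to a phase of \<open>pi / 2\<close>.
\<close>

lemma layer_high_index_lower:
  assumes p: "0 < p" "p < q" "q \<le> S" "im_sq p = 0" and pos: "\<And>s. s \<in> {p<..<q} \<Longrightarrow> 0 < im_sq s"
    and q: "im_sq q = 0"
  shows "pi / (2 * n2 * Re \<kappa>) < q - p"
proof (rule ccontr)
  assume "\<not> ?thesis"
  then have le: "q - p \<le> pi / (2 * n2 * Re \<kappa>)" by simp
  obtain X where X: "d p = \<i> * \<kappa> * X * Y p" "0 < Re X" "Re ((Y p)\<^sup>2) * Im X < 0"
    by (rule impedance_at_zero[of p]) (use p in auto)
  have Rep: "0 < Re ((Y p)\<^sup>2)" by (rule zero_followed_by_sign(1)[of p q]) (use p pos in auto)
  then have ImX: "Im X < 0" using X(3) by (simp add: mult_less_0_iff)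
  have Req: "Re ((Y q)\<^sup>2) < 0" by (rule zero_preceded_by_pos[of q p]) (use p q pos in auto)
  have Yp: "Y p \<noteq> 0" using Y_nz[of p] p by auto
  have cn: "\<forall>s\<in>{p<..<q}. ctrl s = n2\<^sup>2" using pos by (force simp: ctrl_eq)
  have real: "(Y p)\<^sup>2 = of_real (Re ((Y p)\<^sup>2))" "(Y q)\<^sup>2 = of_real (Re ((Y q)\<^sup>2))"
    using p(4) q by (auto simp: complex_eq_iff im_sq_def)
  have "(Y q / Y p)\<^sup>2 = of_real (Re ((Y q)\<^sup>2) / Re ((Y p)\<^sup>2))"
    by (simp only: power_divide of_real_divide real[symmetric])
  then have "Re (Y q / Y p) = 0"
    by (intro Re_zero_if_square_neg) (use Rep Req in \<open>auto simp: divide_less_0_iff\<close>)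
  moreover
  let ?w = "phase n2 (q - p)" and ?r = "growth n2 (q - p)"
  have w: "0 < ?w" "?w \<le> pi / 2"
    using le p(2) n2_pos Re_\<kappa> by (auto simp: phase_def field_simps)
  have "0 \<le> cos ?w" "0 < sin ?w"
    using w by (auto intro!: cos_ge_zero sin_gt_zero) 
  moreover have "0 < cosh ?r + Re X / n2 * sinh ?r"
    using X(2) n2_pos growth_pos[OF n2_pos, of "q - p"] p
    by (intro add_pos_pos mult_pos_pos divide_pos_pos cosh_real_pos; simp)
  moreover have "Im X / n2 * (sin ?w * cosh ?r) < 0"
    using \<open>0 < sin ?w\<close> ImX n2_pos by (simp add: mult_less_0_iff divide_less_0_iff cosh_real_pos)
  ultimately have "0 < cos ?w * (cosh ?r + Re X / n2 * sinh ?r) - Im X / n2 * (sin ?w * cosh ?r)"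
    by (smt (verit) mult_nonneg_nonneg)
  moreover have "q \<in> {p..q}" using p by simp
  note relative_profile[OF n2_pos p(2) cn this X(1) Yp]
  ultimately show False using \<open>Re (Y q / Y p) = 0\<close> by simp
qed

text \<open>
  The energy identity at \<open>0\<close> gives \<open>im_sq 0 > 0\<close>, so the central layer has high index, and there \<open>Y\<close> is
  \<open>Y 0\<close> times a cosine. After a phase of \<open>pi / 2\<close> the squared cosine is negative and \<open>im_sq\<close> would have the
  wrong sign.
\<close>

lemma central_even_profile:
  assumes d0: "d 0 = 0" and q: "0 < q" "q \<le> S" "im_sq q = 0" and nz: "\<And>s. s \<in> {0<..<q} \<Longrightarrow> im_sq s \<noteq> 0"
  shows "\<And>s. s \<in> {0<..<q} \<Longrightarrow> 0 < im_sq s" and "q < pi / (2 * n2 * Re \<kappa>)"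
proof -
  have "ctrl 0 * im_sq 0 = lam" using energy[of 0] S_pos d0 by simp
  then have g0: "0 < im_sq 0" using lam_pos ctrl_bounds(3)[of 0] by (metis zero_less_mult_pos)
  show pos: "0 < im_sq s" if s: "s \<in> {0<..<q}" for s
  proof (rule ccontr)
    assume "\<not> 0 < im_sq s"
    then have "\<exists>t\<ge>0. t \<le> s \<and> im_sq t = 0"
      by (intro IVT2' continuous_on_im_sq) (use g0 s in auto)
    then obtain t where "0 \<le> t" "t \<le> s" "im_sq t = 0" by blast
    then show False using nz[of t] g0 s by (cases "t = 0") auto
  qed
  have cn: "\<forall>s\<in>{0<..<q}. ctrl s = n2\<^sup>2" using pos by (force simp: ctrl_eq)
  let ?L = "pi / (2 * n2 * Re \<kappa>)"
  have L: "0 < ?L" using n2_pos Re_\<kappa> by simp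
  have ph: "phase n2 ?L = pi / 2" using n2_pos Re_\<kappa> by (simp add: phase_def)
  show "q < ?L"
  proof (rule ccontr)
    assume "\<not> ?thesis"
    then have Lq: "?L \<in> {0..q}" using L by simp
    have "Y ?L = Y 0 * cos (Complex (pi / 2) (- growth n2 ?L))"
      using layer_formula[OF n2_pos q(1) cn Lq] by (simp only: kappa_times ph diff_0_right d0) simp
    then have "(Y ?L)\<^sup>2 = - of_real ((sinh (growth n2 ?L))\<^sup>2) * (Y 0)\<^sup>2"
      by (simp only: power_mult_distrib cos_squared_at_quarter) simp
    then have "im_sq ?L = - (sinh (growth n2 ?L))\<^sup>2 * im_sq 0" by (simp add: im_sq_def)
    also have "\<dots> < 0" using g0 growth_pos[OF n2_pos L] by simp
    finally have "im_sq ?L < 0" .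
    moreover have "0 \<le> im_sq ?L" using pos[of ?L] q(3) Lq L by (cases "?L = q") auto
    ultimately show False by simp
  qed
qed

text \<open>
  If \<open>Y 0 = 0\<close>, the profile on the central layer is a sine whose squared amplitude has, by the energy
  identity at \<open>0\<close>, positive imaginary part.
\<close>

lemma sine_profile:
  assumes Y0: "Y 0 = 0" and n: "0 < n" and q: "0 < q" and cn: "\<forall>s\<in>{0<..<q}. ctrl s = n\<^sup>2"
    and s: "s \<in> {0..q}"
  shows "(Y s)\<^sup>2 = (d 0)\<^sup>2 / \<kappa>\<^sup>2 / of_real (n\<^sup>2) * (sin (Complex (phase n s) (- growth n s)))\<^sup>2"
  using layer_formula[OF n q cn s] unfolding kappa_times
  by (simp add: Y0 power_mult_distrib power_divide)

lemma Im_amplitude: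
  assumes Y0: "Y 0 = 0" 
  shows "Im ((d 0)\<^sup>2 / \<kappa>\<^sup>2 / of_real a) = lam / a"
  using energy[of 0] S_pos Y0 by (simp only: Im_divide_of_real) (simp add: im_sq_def)

text \<open>
  The squared sine is positive after a phase of \<open>pi / 2\<close>, where \<open>im_sq\<close> would thus be positive.
\<close>

lemma central_odd_low_index:
  assumes Y0: "Y 0 = 0" and q: "0 < q" "q \<le> S" "im_sq q = 0" and neg: "\<And>s. s \<in> {0<..<q} \<Longrightarrow> im_sq s < 0"
  shows "q < pi / (2 * n1 * Re \<kappa>)"
proof (rule ccontr)
  let ?L = "pi / (2 * n1 * Re \<kappa>)"
  have L: "0 < ?L" using n1_pos Re_\<kappa> by simp
  have ph: "phase n1 ?L = pi / 2" using n1_pos Re_\<kappa> by (simp add: phase_def)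
  have cn: "\<forall>s\<in>{0<..<q}. ctrl s = n1\<^sup>2" using neg by (force simp: ctrl_eq)
  assume "\<not> ?thesis"
  then have Lq: "?L \<in> {0..q}" using L by simp
  have "im_sq ?L = lam / n1\<^sup>2 * (cosh (growth n1 ?L))\<^sup>2"
    unfolding im_sq_def sine_profile[OF Y0 n1_pos q(1) cn Lq] ph sin_squared_at_quarter
    by (simp only: Im_mult_of_real Im_amplitude[OF Y0] cosh_minus)
  also have "\<dots> > 0" using lam_pos n_sq by (simp add: cosh_real_pos)
  finally have "0 < im_sq ?L" .
  moreover have "im_sq ?L \<le> 0" using neg[of ?L] q(3) Lq L by (cases "?L = q") auto
  ultimately show False by simp
qed

text \<open>
  The squared sine is negative after a phase of \<open>pi\<close>, which bounds \<open>q\<close> from above. For the lower bound,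
  \<open>(Y q)\<^sup>2\<close> is negative, so the squared amplitude is a negative multiple of the conjugate of the squared
  sine \<open>z\<close>. Up to a phase of \<open>pi / 2\<close> one has \<open>Im z \<le> 0\<close>, and the amplitude would have nonpositive
  imaginary part.
\<close>

lemma central_odd_high_index:
  assumes Y0: "Y 0 = 0" and q: "0 < q" "q \<le> S" "im_sq q = 0" and pos: "\<And>s. s \<in> {0<..<q} \<Longrightarrow> 0 < im_sq s"
  shows "q < pi / (n2 * Re \<kappa>)" and "pi / (2 * n2 * Re \<kappa>) < q"
proof -
  have cn: "\<forall>s\<in>{0<..<q}. ctrl s = n2\<^sup>2" using pos by (force simp: ctrl_eq)
  let ?L = "pi / (n2 * Re \<kappa>)"
  have L: "0 < ?L" using n2_pos Re_\<kappa> by simp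
  have ph: "phase n2 ?L = pi" using n2_pos Re_\<kappa> by (simp add: phase_def)
  show "q < ?L"
  proof (rule ccontr)
    assume "\<not> ?thesis"
    then have Lq: "?L \<in> {0..q}" using L by simp
    have "im_sq ?L = - (lam / n2\<^sup>2 * (sinh (growth n2 ?L))\<^sup>2)"
      unfolding im_sq_def sine_profile[OF Y0 n2_pos q(1) cn Lq] ph sin_squared_at_half
      by (simp only: Im_mult_of_real Im_amplitude[OF Y0] mult_minus_right uminus_complex.sel
          sinh_minus power2_minus)
    also have "\<dots> < 0" using lam_pos n_sq growth_pos[OF n2_pos L] by simp
    finally have "im_sq ?L < 0" .
    moreover have "0 \<le> im_sq ?L" using pos[of ?L] q(3) Lq L by (cases "?L = q") auto
    ultimately show False by simp
  qed
  show "pi / (2 * n2 * Re \<kappa>) < q"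
  proof (rule ccontr)
    assume "\<not> ?thesis"
    then have le: "q \<le> pi / (2 * n2 * Re \<kappa>)" by simp
    let ?w = "phase n2 q" and ?r = "growth n2 q"
    let ?A = "(d 0)\<^sup>2 / \<kappa>\<^sup>2 / of_real (n2\<^sup>2)" and ?z = "(sin (Complex ?w (- ?r)))\<^sup>2"
    have w: "0 < ?w" "?w \<le> pi / 2"
      using le q n2_pos Re_\<kappa> by (auto simp: phase_def field_simps)
    have r: "0 < ?r" using growth_pos[OF n2_pos q(1)] .
    have Imz: "Im ?z \<le> 0"
    proof -
      have "Im ?z = 2 * (sin ?w * cosh ?r) * (- (cos ?w * sinh ?r))"
        by (simp add: power2_eq_square Re_sin Im_sin cosh_def sinh_def field_simps)
      also have "\<dots> \<le> 0"
        using w r by (intro mult_nonneg_nonpos) (auto intro!: mult_nonneg_nonneg sin_ge_zero cos_ge_zero simp: cosh_real_nonneg)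
      finally show ?thesis .
    qed
    have Req: "Re ((Y q)\<^sup>2) < 0" by (rule zero_preceded_by_pos[of q 0]) (use q pos in auto)
    have "?A * ?z = of_real (Re ((Y q)\<^sup>2))"
      using sine_profile[OF Y0 n2_pos q(1) cn, of q] q by (simp add: complex_eq_iff im_sq_def)
    then have "?A * (?z * cnj ?z) = of_real (Re ((Y q)\<^sup>2)) * cnj ?z" by (metis mult.assoc)
    then have "Im (?A * of_real ((norm ?z)\<^sup>2)) = Im (of_real (Re ((Y q)\<^sup>2)) * cnj ?z)"
      by (simp only: complex_norm_square)
    moreover have "Im (of_real a * cnj z) = - a * Im z" for a z by simp
    ultimately have "lam / n2\<^sup>2 * (norm ?z)\<^sup>2 = - Re ((Y q)\<^sup>2) * Im ?z"
      by (simp only: Im_mult_of_real Im_amplitude[OF Y0])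
    moreover have "- Re ((Y q)\<^sup>2) * Im ?z \<le> 0" using Req Imz by (intro mult_nonneg_nonpos) auto
    moreover have "?z \<noteq> 0"
      using Req sine_profile[OF Y0 n2_pos q(1) cn, of q] q by auto
    then have "0 < lam / n2\<^sup>2 * (norm ?z)\<^sup>2" using lam_pos n_sq by simp
    ultimately show False by simp
  qed
qed

end

section \<open>The layer structure\<close>

lemma not_AE_notin_interval:
  assumes "p < q"
  shows "\<not> (AE s in lebesgue. s \<notin> {p<..<q :: real})"
proof
  assume "AE s in lebesgue. s \<notin> {p<..<q}"
  then have "negligible {p<..<q}" by (simp only: AE_lebesgue_iff_negligible not_not Collect_mem_eq)
  moreover have "\<not> negligible {p<..<q}" by (rule open_not_negligible) (use assms in auto)
  ultimately show False by blast
qed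

lemma AE_values_agree:
  fixes p q v w :: real
  assumes "p < q" and "AE s\<in>I in lebesgue. f s = v" and "AE s\<in>J in lebesgue. f s = w"
    and "{p<..<q} \<subseteq> I" "{p<..<q} \<subseteq> J"
  shows "v = w"
proof (rule ccontr)
  assume "v \<noteq> w"
  from assms(2,3) have "AE s in lebesgue. s \<notin> {p<..<q}"
  proof eventually_elim
    case (elim s)
    show ?case
    proof
      assume "s \<in> {p<..<q}"
      then have "s \<in> I" "s \<in> J" by (rule subsetD[OF assms(4)], rule subsetD[OF assms(5)])
      with elim \<open>v \<noteq> w\<close> show False by simp
    qed
  qed
  with not_AE_notin_interval[OF assms(1)] show False by (rule notE)
qed

lemma const_value_eq:
  assumes "p < q" "{p<..<q} \<subseteq> I" "AE s\<in>I in lebesgue. f s = v"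
  shows "const_value f I = v"
  unfolding const_value_def ae_const_on_def
proof (rule the_equality)
  show "AE s\<in>I in lebesgue. f s = v" by fact
  show "w = v" if "AE s\<in>I in lebesgue. f s = w" for w
    by (rule AE_values_agree[OF assms(1) that assms(3,2,2)])
qed

lemma ess_right_lim_eq:
  assumes lim: "ess_right_lim f p v" and pq: "p < q" and ae: "AE s\<in>{p<..<q} in lebesgue. f s = w"
  shows "v = w"
proof (rule ccontr)
  assume "v \<noteq> w"
  then have "0 < \<bar>w - v\<bar>" by simp
  with lim obtain e where e: "0 < e" "AE s\<in>{p<..<p + e} in lebesgue. \<bar>f s - v\<bar> < \<bar>w - v\<bar>"
    unfolding ess_right_lim_def by blast
  have "AE s in lebesgue. s \<notin> {p<..<min q (p + e)}"
    using e(2) ae by eventually_elim auto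
  then show False using not_AE_notin_interval[of p "min q (p + e)"] pq e(1) by auto
qed

text \<open>
  If the central layer is not the whole interval, then both switch points next to \<open>0\<close> lie in it, so there is a
  central layer bounded by switch points and there are two edge layers.
\<close>

locale layered_profile = extremal_profile +
  assumes central_ne: "central_layer (- S) S (switch_points n1 n2 Y) \<noteq> {- S<..<S}"
begin

lemma switch_mono: "i < j \<longleftrightarrow> b i < b j"
  using switches by (auto simp: switch_sequence_def strict_mono_less)

lemma switch_mem: "b j \<in> Sw"
  using switches by (auto simp: switch_sequence_def)

lemma switch_index: "s \<in> Sw \<Longrightarrow> \<exists>j. s = b j"
  using switches by (auto simp: switch_sequence_def)

lemma switch_gap:
  assumes "t \<notin> Sw"
  obtains j where "b j < t" "t < b (j + 1)"
proof -
  obtain i where i: "b i < t"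
    using switches unfolding switch_sequence_def bdd_below_def by (metis linorder_not_le rangeE)
  obtain k where k: "t < b k"
    using switches unfolding switch_sequence_def bdd_above_def by (metis linorder_not_le rangeE)
  let ?A = "{j \<in> {i..k}. b j < t}"
  have ik: "i < k" using i k by (simp add: switch_mono)
  have fin: "finite ?A" by (rule finite_subset[of _ "{i..k}"]) auto
  moreover have "i \<in> ?A" using i ik by simp
  then have "?A \<noteq> {}" by blast
  ultimately have m: "Max ?A \<in> ?A" by (rule Max_in)
  then have "Max ?A < k" using k by (auto simp: switch_mono)
  then have "\<not> b (Max ?A + 1) < t"
    using m Max_ge[OF fin, of "Max ?A + 1"] by auto
  moreover have "b (Max ?A + 1) \<noteq> t" using assms switch_mem by metis
  ultimately show thesis using m by (intro that[of "Max ?A"]) auto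
qed

lemma gap_no_switch:
  assumes "b j < s" "s < b (j + 1)"
  shows "s \<notin> Sw"
proof
  assume "s \<in> Sw"
  then obtain i where "s = b i" using switch_index by blast
  then show False using assms switch_mono[of j i] switch_mono[of i "j + 1"] by auto
qed

definition first_switch :: real where "first_switch = first_pos Sw"

text \<open>
  By evenness of \<open>im_sq\<close> the reflections of the two switch points next to \<open>0\<close> are switch points as well,
  and none of the four can lie strictly between the original two.
\<close>

lemma first_switch_facts: "first_switch \<in> Sw" "0 < first_switch" "first_switch < S" "\<And>s. s \<in> {0<..<first_switch} \<Longrightarrow> s \<notin> Sw" "first_neg Sw = - first_switch"
proof -
  obtain j where j: "b j < 0" "0 < b (j + 1)" using switch_gap[OF zero_not_switch] by blast
  have fp: "first_switch = b (j + 1)"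
    unfolding first_switch_def first_pos_def
    by (rule Least_equality) (use j switch_mem gap_no_switch[of j] in \<open>auto simp: not_less[symmetric]\<close>)
  have fn: "first_neg Sw = b j"
    unfolding first_neg_def
    by (rule Greatest_equality) (use j switch_mem gap_no_switch[of j] in \<open>auto simp: not_less[symmetric]\<close>)
  have "first_neg Sw \<in> {- S..S}" "first_switch \<in> {- S..S}"
    using central_ne by (auto simp: central_layer_def first_switch_def split: if_splits)
  then have in_S: "b j \<in> {- S..S}" "b (j + 1) \<in> {- S..S}" by (auto simp: fp fn)
  show "first_switch \<in> Sw" "0 < first_switch" using fp j switch_mem by auto
  show "first_switch < S" using in_S fp S_not_switch switch_mem[of "j + 1"] by (auto simp: less_le)
  show "s \<notin> Sw" if "s \<in> {0<..<first_switch}" for s using gap_no_switch[of j s] j that fp by auto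
  have "- b j \<in> Sw" "- b (j + 1) \<in> Sw" using switch_uminus in_S switch_mem by blast+
  then have "\<not> - b j < b (j + 1)" "\<not> b j < - b (j + 1)"
    using gap_no_switch[of j "- b j"] gap_no_switch[of j "- b (j + 1)"] j by auto
  then show "first_neg Sw = - first_switch" using fp fn by simp
qed

lemma central_layer_eq: "central_layer (- S) S Sw = {- first_switch<..<first_switch}"
  using first_switch_facts(2,3,5) by (simp add: central_layer_def first_switch_def[symmetric])

definition last_switch :: real where "last_switch = (SOME t. t \<in> Sw \<and> t < S \<and> (\<forall>s\<in>{t<..<S}. s \<notin> Sw))"

lemma last_switch_facts: "last_switch \<in> Sw" "first_switch \<le> last_switch" "last_switch < S" "\<And>s. s \<in> {last_switch<..<S} \<Longrightarrow> s \<notin> Sw"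
proof -
  obtain j where j: "b j < S" "S < b (j + 1)" using switch_gap[OF S_not_switch(1)] by blast
  have ex: "\<exists>t. t \<in> Sw \<and> t < S \<and> (\<forall>s\<in>{t<..<S}. s \<notin> Sw)"
    using switch_mem[of j] j gap_no_switch[of j] by (intro exI[of _ "b j"]) auto
  have 1: "last_switch \<in> Sw \<and> last_switch < S \<and> (\<forall>s\<in>{last_switch<..<S}. s \<notin> Sw)"
    unfolding last_switch_def by (rule someI_ex[OF ex])
  then show "last_switch \<in> Sw" "last_switch < S" "\<And>s. s \<in> {last_switch<..<S} \<Longrightarrow> s \<notin> Sw" by blast+
  show "first_switch \<le> last_switch"
  proof (rule ccontr)
    assume "\<not> first_switch \<le> last_switch"
    then have "first_switch \<in> {last_switch<..<S}" using first_switch_facts(3) by simp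
    with 1 first_switch_facts(1) show False by blast
  qed
qed

lemma no_switch_left: "s \<in> {- S<..<- last_switch} \<Longrightarrow> s \<notin> Sw"
  using last_switch_facts(4)[of "- s"] switch_uminus[of s] last_switch_facts(2) first_switch_facts(2) by auto

lemma minus_last_switch: "- last_switch \<in> Sw"
  using switch_uminus[of last_switch] last_switch_facts first_switch_facts by auto

lemma right_edge_eq: "right_edge_layer (- S) S Sw = {last_switch<..<S}"
  unfolding right_edge_layer_def central_layer_eq
proof (rule Greatest_equality)
  have "(last_switch + S) / 2 \<in> {last_switch<..<S}" "(last_switch + S) / 2 \<notin> {- first_switch<..<first_switch}" using last_switch_facts first_switch_facts by auto
  then have ne: "{last_switch<..<S} \<noteq> {- first_switch<..<first_switch}" by metis
  show "(\<exists>s. - S \<le> s \<and> s < S \<and> {last_switch<..<S} = {s<..<S}) \<and> {last_switch<..<S} \<noteq> {- first_switch<..<first_switch} \<and> {last_switch<..<S} \<inter> Sw = {}"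
    by (intro conjI ne exI[of _ last_switch]) (use last_switch_facts first_switch_facts in auto)
  fix J assume "(\<exists>s. - S \<le> s \<and> s < S \<and> J = {s<..<S}) \<and> J \<noteq> {- first_switch<..<first_switch} \<and> J \<inter> Sw = {}"
  then obtain s where s: "J = {s<..<S}" "J \<inter> Sw = {}" by blast
  then have "last_switch \<le> s" using last_switch_facts(1,3) by (metis IntI empty_iff greaterThanLessThan_iff linorder_not_less)
  then show "J \<le> {last_switch<..<S}" using s by auto
qed

lemma left_edge_eq: "left_edge_layer (- S) S Sw = {- S<..<- last_switch}"
  unfolding left_edge_layer_def central_layer_eq
proof (rule Greatest_equality)
  have "- ((last_switch + S) / 2) \<in> {- S<..<- last_switch}" "- ((last_switch + S) / 2) \<notin> {- first_switch<..<first_switch}" using last_switch_facts first_switch_facts by auto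
  then have ne: "{- S<..<- last_switch} \<noteq> {- first_switch<..<first_switch}" by metis
  show "(\<exists>s. - S < s \<and> s \<le> S \<and> {- S<..<- last_switch} = {- S<..<s}) \<and> {- S<..<- last_switch} \<noteq> {- first_switch<..<first_switch} \<and> {- S<..<- last_switch} \<inter> Sw = {}"
    by (intro conjI ne exI[of _ "- last_switch"]) (use last_switch_facts first_switch_facts no_switch_left in auto)
  fix J assume "(\<exists>s. - S < s \<and> s \<le> S \<and> J = {- S<..<s}) \<and> J \<noteq> {- first_switch<..<first_switch} \<and> J \<inter> Sw = {}"
  then obtain s where s: "J = {- S<..<s}" "J \<inter> Sw = {}" by blast
  then have "s \<le> - last_switch" using last_switch_facts(3) minus_last_switch
    by (metis IntI empty_iff greaterThanLessThan_iff linorder_not_less neg_less_iff_less)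
  then show "J \<le> {- S<..<- last_switch}" using s by auto
qed

lemma len_interval: "p \<le> q \<Longrightarrow> len {p<..<q} = q - p"
  by (simp add: measure_completion)

text \<open>
  The origin is excluded, because the control may take an exceptional value there if \<open>Y 0 = 0\<close>.
\<close>

lemma AE_eps_on:
  assumes "- S \<le> p" "q \<le> S" "\<And>s. s \<in> {p<..<q} \<Longrightarrow> s \<noteq> 0 \<Longrightarrow> ctrl s = v"
  shows "AE s\<in>{p<..<q} in lebesgue. \<epsilon> s = v"
proof -
  have "AE s in lebesgue. s \<noteq> (0 :: real)"
    by (simp only: AE_lebesgue_iff_negligible not_not singleton_conv) simp
  with AE_eps_eq_ctrl show ?thesis
    by eventually_elim (use assms in auto)
qed

lemma im_sq_nz_if_not_switch: "s \<in> {- S..S} \<Longrightarrow> s \<noteq> 0 \<Longrightarrow> s \<notin> Sw \<Longrightarrow> im_sq s \<noteq> 0"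
  using switch_iff by blast

lemma im_sq_edge: 
  assumes "s \<in> {last_switch<..<S}" shows "0 < im_sq s \<longleftrightarrow> 0 < im_sq S" "im_sq s < 0 \<longleftrightarrow> im_sq S < 0"
proof -
  have nz: "im_sq t \<noteq> 0" if "t \<in> {last_switch<..S}" for t
    using that last_switch_facts(2) last_switch_facts(4)[of t] first_switch_facts(2) S_not_switch
    by (cases "t = S"; intro im_sq_nz_if_not_switch) auto
  have "connected (im_sq ` {last_switch<..S})"
    by (intro connected_continuous_image continuous_on_im_sq) simp
  moreover have "im_sq s \<in> im_sq ` {last_switch<..S}" "im_sq S \<in> im_sq ` {last_switch<..S}"
    using assms last_switch_facts(3) by auto
  moreover have "0 \<notin> im_sq ` {last_switch<..S}" using nz by force
  ultimately have "\<not> (im_sq s \<le> 0 \<and> 0 \<le> im_sq S)" "\<not> (im_sq S \<le> 0 \<and> 0 \<le> im_sq s)"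
    unfolding connected_iff_interval by blast+
  then show "0 < im_sq s \<longleftrightarrow> 0 < im_sq S" "im_sq s < 0 \<longleftrightarrow> im_sq S < 0" by linarith+
qed

lemma AE_eps_edge: "AE s\<in>{last_switch<..<S} in lebesgue. \<epsilon> s = ctrl S" "AE s\<in>{- S<..<- last_switch} in lebesgue. \<epsilon> s = ctrl S"
proof -
  have r: "ctrl s = ctrl S" if "s \<in> {last_switch<..<S}" for s using im_sq_edge(1)[OF that] by (simp add: ctrl_eq)
  have l: "ctrl s = ctrl S" if "s \<in> {- S<..<- last_switch}" for s
    using r[of "- s"] that last_switch_facts(2) first_switch_facts(2) im_sq_even[of s] by (auto simp: ctrl_eq)
  show "AE s\<in>{last_switch<..<S} in lebesgue. \<epsilon> s = ctrl S" "AE s\<in>{- S<..<- last_switch} in lebesgue. \<epsilon> s = ctrl S"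
    using last_switch_facts(2,3) first_switch_facts(2) by (intro AE_eps_on r l; simp)+
qed

lemma eps_edge_eq: "eps_edge \<epsilon> (- S) S Sw = ctrl S"
  unfolding eps_edge_def left_edge_eq right_edge_eq
proof (rule const_value_eq[OF last_switch_facts(3)])
  show "AE s\<in>{- S<..<- last_switch} \<union> {last_switch<..<S} in lebesgue. \<epsilon> s = ctrl S"
    using AE_eps_edge by eventually_elim auto
qed auto

lemma im_sq_nz_central: "s \<in> {0<..<first_switch} \<Longrightarrow> im_sq s \<noteq> 0"
  using first_switch_facts(3) first_switch_facts(4)[of s] by (intro im_sq_nz_if_not_switch) auto

lemma central_sign: "(\<forall>s\<in>{0<..<first_switch}. 0 < im_sq s) \<or> (\<forall>s\<in>{0<..<first_switch}. im_sq s < 0)"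
  by (rule im_sq_sign_const) (rule im_sq_nz_central)

lemma AE_eps_central:
  assumes "\<And>s. s \<in> {0<..<first_switch} \<Longrightarrow> ctrl s = v"
  shows "AE s\<in>{- first_switch<..<first_switch} in lebesgue. \<epsilon> s = v"
proof (rule AE_eps_on)
  show "ctrl s = v" if "s \<in> {- first_switch<..<first_switch}" "s \<noteq> 0" for s
    using assms[of s] assms[of "- s"] im_sq_even[of s] that first_switch_facts(2,3)
    by (cases "0 < s") (auto simp: ctrl_eq)
qed (use first_switch_facts in auto)

lemma eps_centr_eq: "(\<And>s. s \<in> {0<..<first_switch} \<Longrightarrow> ctrl s = v) \<Longrightarrow> eps_centr \<epsilon> (- S) S Sw = v"
  unfolding eps_centr_def central_layer_eq
  using first_switch_facts(2) by (intro const_value_eq[of "- first_switch" first_switch] AE_eps_central) auto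

lemma im_sq_first_switch: "im_sq first_switch = 0"
  using first_switch_facts(1) by (rule switch_is_zero)

lemma index_sq_ne: "n1\<^sup>2 \<noteq> n2\<^sup>2"
  using n_sq by simp

text \<open>
  Only the switch point at which the right edge layer begins enters the length estimates, so that they
  apply although the layer does not end at a switch point.
\<close>

lemma edge_bounds:
  "eps_edge \<epsilon> (- S) S Sw = n1\<^sup>2 \<Longrightarrow> S - last_switch < pi / (2 * n1 * Re \<kappa>)"
  "eps_edge \<epsilon> (- S) S Sw = n2\<^sup>2 \<Longrightarrow> S - last_switch < pi / (n1 * Re \<kappa>)"
  "ninf = n2 \<Longrightarrow> eps_edge \<epsilon> (- S) S Sw = n1\<^sup>2"
  "ninf = n1 \<Longrightarrow> eps_edge \<epsilon> (- S) S Sw = n2\<^sup>2"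
proof -
  have last_switch: "0 < last_switch" "last_switch < S" "S \<le> S" "im_sq last_switch = 0" using last_switch_facts first_switch_facts switch_is_zero by auto
  have gS: "im_sq S \<noteq> 0" using edge_energy lam_pos by auto
  show "S - last_switch < pi / (2 * n1 * Re \<kappa>)" if "eps_edge \<epsilon> (- S) S Sw = n1\<^sup>2"
    by (rule layer_low_index[OF last_switch]) (use that gS index_sq_ne im_sq_edge in \<open>auto simp: eps_edge_eq ctrl_eq split: if_splits\<close>)
  show "S - last_switch < pi / (n1 * Re \<kappa>)" if "eps_edge \<epsilon> (- S) S Sw = n2\<^sup>2"
  proof -
    have "S - last_switch < pi / (n2 * Re \<kappa>)"
      by (rule layer_high_index_upper[OF last_switch]) (use that gS index_sq_ne im_sq_edge in \<open>auto simp: eps_edge_eq ctrl_eq split: if_splits\<close>)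
    also have "\<dots> \<le> pi / (n1 * Re \<kappa>)"
      using n1_pos n1_less_n2 Re_\<kappa> by (intro divide_left_mono mult_right_mono) auto
    finally show ?thesis .
  qed
  show "eps_edge \<epsilon> (- S) S Sw = n1\<^sup>2" if "ninf = n2"
    using edge_energy lam_pos that by (auto simp: eps_edge_eq ctrl_eq split: if_splits)
  show "eps_edge \<epsilon> (- S) S Sw = n2\<^sup>2" if "ninf = n1"
    using edge_energy lam_pos that by (auto simp: eps_edge_eq ctrl_eq split: if_splits)
qed

lemma central_bounds_even:
  assumes "d 0 = 0"
  shows "2 * first_switch < pi / (sqrt (eps_centr \<epsilon> (- S) S Sw) * Re \<kappa>)"
proof -
  note * = central_even_profile[OF assms first_switch_facts(2) less_imp_le[OF first_switch_facts(3)] im_sq_first_switch im_sq_nz_central]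
  have "eps_centr \<epsilon> (- S) S Sw = n2\<^sup>2"
    by (rule eps_centr_eq) (use *(1) in \<open>simp add: ctrl_eq\<close>)
  moreover have "2 * first_switch < 2 * (pi / (2 * n2 * Re \<kappa>))"
    using *(2) by (rule mult_strict_left_mono) simp_all
  ultimately show ?thesis using n2_pos by simp
qed

lemma central_bounds_odd:
  assumes "Y 0 = 0"
  shows "eps_centr \<epsilon> (- S) S Sw = n2\<^sup>2 \<Longrightarrow> pi / (n2 * Re \<kappa>) < 2 * first_switch \<and> 2 * first_switch < 2 * pi / (n2 * Re \<kappa>)"
    and "eps_centr \<epsilon> (- S) S Sw = n1\<^sup>2 \<Longrightarrow> 2 * first_switch < pi / (n1 * Re \<kappa>)"
proof -
  note first_switch = first_switch_facts(2) less_imp_le[OF first_switch_facts(3)] im_sq_first_switch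
  have low: "eps_centr \<epsilon> (- S) S Sw = n1\<^sup>2" if "\<forall>s\<in>{0<..<first_switch}. im_sq s < 0"
    by (rule eps_centr_eq) (use that in \<open>force simp: ctrl_eq\<close>)
  have high: "eps_centr \<epsilon> (- S) S Sw = n2\<^sup>2" if "\<forall>s\<in>{0<..<first_switch}. 0 < im_sq s"
    by (rule eps_centr_eq) (use that in \<open>force simp: ctrl_eq\<close>)
  show "pi / (n2 * Re \<kappa>) < 2 * first_switch \<and> 2 * first_switch < 2 * pi / (n2 * Re \<kappa>)"
    if "eps_centr \<epsilon> (- S) S Sw = n2\<^sup>2"
  proof -
    have "\<forall>s\<in>{0<..<first_switch}. 0 < im_sq s" using central_sign low that index_sq_ne by auto
    then have u: "first_switch < pi / (n2 * Re \<kappa>)" and l: "pi / (2 * n2 * Re \<kappa>) < first_switch"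
      using central_odd_high_index[OF assms first_switch] by auto
    show ?thesis
      using mult_strict_left_mono[OF l, of 2] mult_strict_left_mono[OF u, of 2] by simp
  qed
  show "2 * first_switch < pi / (n1 * Re \<kappa>)" if "eps_centr \<epsilon> (- S) S Sw = n1\<^sup>2"
  proof -
    have "\<forall>s\<in>{0<..<first_switch}. im_sq s < 0" using central_sign high that index_sq_ne by auto
    then have u: "first_switch < pi / (2 * n1 * Re \<kappa>)"
      using central_odd_low_index[OF assms first_switch] by auto
    show ?thesis using mult_strict_left_mono[OF u, of 2] by simp
  qed
qed

lemma positive_layer_bounds:
  assumes pq: "0 < p" "p < q" "q \<le> S" "im_sq p = 0" "im_sq q = 0" and ns: "\<And>s. s \<in> {p<..<q} \<Longrightarrow> s \<notin> Sw"
  obtains (low) "\<And>s. s \<in> {p<..<q} \<Longrightarrow> ctrl s = n1\<^sup>2" "q - p < pi / (2 * n1 * Re \<kappa>)"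
    | (high) "\<And>s. s \<in> {p<..<q} \<Longrightarrow> ctrl s = n2\<^sup>2" "pi / (2 * n2 * Re \<kappa>) < q - p" "q - p < pi / (n2 * Re \<kappa>)"
proof -
  have nz: "im_sq s \<noteq> 0" if "s \<in> {p<..<q}" for s
    using ns[OF that] that pq by (intro im_sq_nz_if_not_switch) auto
  consider "\<forall>s\<in>{p<..<q}. im_sq s < 0" | "\<forall>s\<in>{p<..<q}. 0 < im_sq s"
    using im_sq_sign_const[OF nz] by blast
  then show thesis
  proof cases
    case 1
    then show thesis using layer_low_index[OF pq(1-4)] by (intro low) (force simp: ctrl_eq)+
  next
    case 2
    then show thesis
      using layer_high_index_upper[OF pq(1-4)] layer_high_index_lower[OF pq(1-4) _ pq(5)]
      by (intro high) (force simp: ctrl_eq)+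
  qed
qed

text \<open>
  To the left of \<open>0\<close> the rotation is clockwise and the flux negative; evenness reduces this case to the
  reflected layer.
\<close>

lemma layer_bounds:
  assumes pq: "p < q" "- S \<le> p" "q \<le> S" "im_sq p = 0" "im_sq q = 0" and ns: "\<And>s. s \<in> {p<..<q} \<Longrightarrow> s \<notin> Sw"
    and side: "0 < p \<or> q < 0"
  obtains (low) "\<And>s. s \<in> {p<..<q} \<Longrightarrow> ctrl s = n1\<^sup>2" "q - p < pi / (2 * n1 * Re \<kappa>)"
    | (high) "\<And>s. s \<in> {p<..<q} \<Longrightarrow> ctrl s = n2\<^sup>2" "pi / (2 * n2 * Re \<kappa>) < q - p" "q - p < pi / (n2 * Re \<kappa>)"
proof (cases "0 < p")
  case True
  then show thesis by (rule positive_layer_bounds[OF _ pq(1,3-5) ns]) (use low high in blast)+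
next
  case False
  with side have q: "q < 0" by simp
  have g': "im_sq (- q) = 0" "im_sq (- p) = 0" using im_sq_even[of q] im_sq_even[of p] pq by auto
  have ns': "s \<notin> Sw" if "s \<in> {- q<..<- p}" for s
    using ns[of "- s"] switch_uminus[of s] that pq by auto
  have refl: "ctrl s = v" if "\<And>s. s \<in> {- q<..<- p} \<Longrightarrow> ctrl s = v" "s \<in> {p<..<q}" for s v
    using that(1)[of "- s"] that(2) im_sq_even[of s] pq by (simp add: ctrl_eq)
  show thesis
  proof (rule positive_layer_bounds[of "- q" "- p"])
    show "0 < - q" "- q < - p" "- p \<le> S" "im_sq (- q) = 0" "im_sq (- p) = 0"
      using q pq g' by auto
  next
    fix s assume "s \<in> {- q<..<- p}" then show "s \<notin> Sw" by (rule ns')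
  next
    assume "\<And>s. s \<in> {- q<..<- p} \<Longrightarrow> ctrl s = n1\<^sup>2" "- p - - q < pi / (2 * n1 * Re \<kappa>)"
    then show thesis by (intro low) (auto intro: refl)
  next
    assume "\<And>s. s \<in> {- q<..<- p} \<Longrightarrow> ctrl s = n2\<^sup>2" "pi / (2 * n2 * Re \<kappa>) < - p - - q"
      "- p - - q < pi / (n2 * Re \<kappa>)"
    then show thesis by (intro high) (auto intro: refl)
  qed
qed

text \<open>
  Zeros of \<open>im_sq\<close> other than \<open>0\<close> are transversal, so \<open>\<epsilon>\<close> takes the two values \<open>n1\<^sup>2\<close> and \<open>n2\<^sup>2\<close> on sets
  of positive measure near a switch point.
\<close>

lemma switch_not_in_const_interval:
  assumes pq: "- S \<le> p" "q \<le> S" and ae: "AE s\<in>{p<..<q} in lebesgue. \<epsilon> s = v" and t: "t \<in> {p<..<q}"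
  shows "t \<notin> Sw"
proof
  assume "t \<in> Sw"
  then have gt: "im_sq t = 0" and "t \<noteq> 0" using switch_is_zero zero_not_switch by auto
  then have Wt: "rot t \<noteq> 0" using rot_pos[of t] rot_neg[of t] t pq by (cases "0 < t") auto
  consider "eventually (\<lambda>s. im_sq s < 0) (at_left t)" "eventually (\<lambda>s. 0 < im_sq s) (at_right t)"
    | "eventually (\<lambda>s. 0 < im_sq s) (at_left t)" "eventually (\<lambda>s. im_sq s < 0) (at_right t)"
    using transversal_zero[OF gt Wt] eventually_of_deriv[OF gt] by (metis linorder_neqE_linordered_idom)
  then obtain l r where lr: "l \<noteq> r" "eventually (\<lambda>s. ctrl s = l) (at_left t)" "eventually (\<lambda>s. ctrl s = r) (at_right t)"
  proof cases
    case 1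
    have "eventually (\<lambda>s. ctrl s = n1\<^sup>2) (at_left t)" "eventually (\<lambda>s. ctrl s = n2\<^sup>2) (at_right t)"
      by (rule eventually_mono[OF 1(1)], simp add: ctrl_eq, rule eventually_mono[OF 1(2)], simp add: ctrl_eq)
    with index_sq_ne that show thesis by blast
  next
    case 2
    have "eventually (\<lambda>s. ctrl s = n2\<^sup>2) (at_left t)" "eventually (\<lambda>s. ctrl s = n1\<^sup>2) (at_right t)"
      by (rule eventually_mono[OF 2(1)], simp add: ctrl_eq, rule eventually_mono[OF 2(2)], simp add: ctrl_eq)
    with index_sq_ne that show thesis by metis
  qed
  obtain a where a: "a < t" "\<And>s. a < s \<Longrightarrow> s < t \<Longrightarrow> ctrl s = l"
    using lr(2) unfolding eventually_at_left_field by blast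
  obtain e where e: "t < e" "\<And>s. t < s \<Longrightarrow> s < e \<Longrightarrow> ctrl s = r"
    using lr(3) unfolding eventually_at_right_field by blast
  have "v = l"
  proof (rule AE_values_agree[of "max a p" t, OF _ ae])
    show "AE s\<in>{max a p<..<t} in lebesgue. \<epsilon> s = l" by (rule AE_eps_on) (use a t pq in auto)
  qed (use a t in auto)
  moreover have "v = r"
  proof (rule AE_values_agree[of t "min e q", OF _ ae])
    show "AE s\<in>{t<..<min e q} in lebesgue. \<epsilon> s = r" by (rule AE_eps_on) (use e t pq in auto)
  qed (use e t in auto)
  ultimately show False using lr(1) by simp
qed

text \<open>
  A layer contains no switch point, hence lies in a gap \<open>(b j, b (j + 1))\<close> of the switch sequence. If this gap
  reached beyond \<open>- S\<close> or \<open>S\<close> or contained \<open>0\<close>, maximality would make the layer an edge or the central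
  layer. Otherwise maximality makes it the whole gap.
\<close>

lemma ordinary_layer_bounds:
  assumes "ordinary_layer \<epsilon> (- S) S Sw I"
  shows "\<exists>j. I = {b j<..<b (j + 1)}
     \<and> (ess_right_lim \<epsilon> (b j) (n1\<^sup>2) \<longrightarrow> len I < pi / (2 * n1 * Re \<kappa>))
     \<and> (ess_right_lim \<epsilon> (b j) (n2\<^sup>2) \<longrightarrow> pi / (2 * n2 * Re \<kappa>) < len I \<and> len I < pi / (n2 * Re \<kappa>))"
proof -
  have layer: "const_interval \<epsilon> (- S) S I"
    and maximal: "\<And>J. const_interval \<epsilon> (- S) S J \<Longrightarrow> I \<subseteq> J \<Longrightarrow> J = I"
    and not_edge: "I \<noteq> {- first_switch<..<first_switch}" "I \<noteq> {- S<..<- last_switch}" "I \<noteq> {last_switch<..<S}"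
    using assms by (auto simp: ordinary_layer_def is_layer_def central_layer_eq left_edge_eq right_edge_eq)
  then obtain p q v where pq: "p < q" and I: "I = {p<..<q}" and sub: "{p<..<q} \<subseteq> {- S<..<S}"
    and ae: "AE s\<in>{p<..<q} in lebesgue. \<epsilon> s = v"
    unfolding const_interval_def ae_const_on_def by blast
  have bd: "- S \<le> p" "q \<le> S"
    using sub pq by (auto simp: greaterThanLessThan_subseteq_greaterThanLessThan)
  note ns = switch_not_in_const_interval[OF bd ae]
  define m where "m = (p + q) / 2"
  have m: "p < m" "m < q" using pq by (auto simp: m_def)
  have mI: "m \<in> {p<..<q}" using m by simp
  obtain j where j: "b j < m" "m < b (j + 1)" using switch_gap[OF ns[OF mI]] by blast
  have jp: "b j \<le> p" using ns[of "b j"] switch_mem[of j] j(1) m by force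
  have jq: "q \<le> b (j + 1)" using ns[of "b (j + 1)"] switch_mem[of "j + 1"] j(2) m by force
  have const: "J = I" if "J = {x<..<y}" "x \<le> p" "q \<le> y" "- S \<le> x" "y \<le> S" "AE s\<in>J in lebesgue. \<epsilon> s = w" for J x y w
  proof (rule maximal)
    show "const_interval \<epsilon> (- S) S J"
      unfolding const_interval_def ae_const_on_def using that pq
      by (intro conjI exI[of _ x] exI[of _ y] exI[of _ w]) auto
    show "I \<subseteq> J" using that I by auto
  qed
  have lower: "- S < b j"
  proof (rule ccontr)
    assume "\<not> - S < b j"
    then have "b j < - S" using S_not_switch(2) switch_mem[of j] by (metis linorder_neqE_linordered_idom)
    then have "b (j + 1) \<le> - last_switch"
      using gap_no_switch[of j "- last_switch"] minus_last_switch last_switch_facts(3) by force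
    then have "{- S<..<- last_switch} = I"
      by (intro const[OF refl _ _ _ _ AE_eps_edge(2)]) (use bd jq last_switch_facts first_switch_facts in auto)
    then show False using not_edge by simp
  qed
  have upper: "b (j + 1) < S"
  proof (rule ccontr)
    assume "\<not> b (j + 1) < S"
    then have "S < b (j + 1)" using S_not_switch(1) switch_mem[of "j + 1"] by (metis linorder_neqE_linordered_idom)
    then have "last_switch \<le> b j"
      using gap_no_switch[of j last_switch] last_switch_facts by force
    then have "{last_switch<..<S} = I"
      by (intro const[OF refl _ _ _ _ AE_eps_edge(1)]) (use bd jp last_switch_facts first_switch_facts in auto)
    then show False using not_edge by simp
  qed
  have side: "0 < b j \<or> b (j + 1) < 0"
  proof (rule ccontr)
    assume "\<not> ?thesis"
    then have "b j \<le> 0" "0 \<le> b (j + 1)" by simp_all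
    then have "b j < 0" "0 < b (j + 1)"
      using zero_not_switch switch_mem by (metis order_le_less)+
    then have first_switch: "- first_switch \<le> b j" "b (j + 1) \<le> first_switch"
      using gap_no_switch[of j first_switch] gap_no_switch[of j "- first_switch"] first_switch_facts switch_uminus[of first_switch] by force+
    obtain w where "\<And>s. s \<in> {0<..<first_switch} \<Longrightarrow> ctrl s = w"
    proof (cases "\<forall>s\<in>{0<..<first_switch}. 0 < im_sq s")
      case True
      then show thesis by (intro that[of "n2\<^sup>2"]) (simp add: ctrl_eq)
    next
      case False
      then have "\<forall>s\<in>{0<..<first_switch}. im_sq s < 0" using central_sign by blast
      then show thesis by (intro that[of "n1\<^sup>2"]) (force simp: ctrl_eq)
    qed
    from AE_eps_central[OF this] have "{- first_switch<..<first_switch} = I"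
      by (intro const[OF refl]) (use first_switch jp jq first_switch_facts in auto)
    then show False using not_edge by simp
  qed
  have nsj: "s \<notin> Sw" if "s \<in> {b j<..<b (j + 1)}" for s using gap_no_switch[of j s] that by auto
  have jj: "b j < b (j + 1)" using j by simp
  have ends: "- S \<le> b j" "b (j + 1) \<le> S" "im_sq (b j) = 0" "im_sq (b (j + 1)) = 0"
    using lower upper switch_is_zero switch_mem by auto
  show ?thesis
  proof (rule layer_bounds[OF jj ends nsj side])
    assume v: "\<And>s. s \<in> {b j<..<b (j + 1)} \<Longrightarrow> ctrl s = n1\<^sup>2" and l: "b (j + 1) - b j < pi / (2 * n1 * Re \<kappa>)"
    have aej: "AE s\<in>{b j<..<b (j + 1)} in lebesgue. \<epsilon> s = n1\<^sup>2" by (rule AE_eps_on) (use ends v in auto)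
    have "{b j<..<b (j + 1)} = I" by (rule const[OF refl jp jq ends(1,2) aej])
    then show ?thesis
      using l jj ess_right_lim_eq[OF _ jj aej, of "n2\<^sup>2"] index_sq_ne by (intro exI[of _ j]) (auto simp: len_interval)
  next
    assume v: "\<And>s. s \<in> {b j<..<b (j + 1)} \<Longrightarrow> ctrl s = n2\<^sup>2"
      and l: "pi / (2 * n2 * Re \<kappa>) < b (j + 1) - b j" "b (j + 1) - b j < pi / (n2 * Re \<kappa>)"
    have aej: "AE s\<in>{b j<..<b (j + 1)} in lebesgue. \<epsilon> s = n2\<^sup>2" by (rule AE_eps_on) (use ends v in auto)
    have "{b j<..<b (j + 1)} = I" by (rule const[OF refl jp jq ends(1,2) aej])
    then show ?thesis
      using l jj ess_right_lim_eq[OF _ jj aej, of "n1\<^sup>2"] index_sq_ne by (intro exI[of _ j]) (auto simp: len_interval)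
  qed
qed

end

theorem corollary8p3:
  fixes n1 n2 ninf :: real and \<kappa> :: complex
    and sm sp lam0 :: real
    and x :: "real \<Rightarrow> sphere" and \<epsilon> :: "real \<Rightarrow> real"
    and y Y :: "real \<Rightarrow> complex" and b :: "int \<Rightarrow> real"
    and B Icentr Iplus Iminus :: "real set" and ecentr eedge :: real
  assumes "0 < n1" and "n1 < n2" and "0 < ninf"
    and "Re \<kappa> > 0" and "Im \<kappa> < 0"
    and "extremal_tuple n1 n2 \<kappa> sm sp x \<epsilon> lam0 y"
    and "extends_to n1 n2 \<kappa> sm sp y Y"
    and "switch_sequence n1 n2 Y b"
    and "\<epsilon> \<in> Fsym n1 n2 ninf"
    and "sp = - sm" and "sp > 0"
    and "shortest_interval ninf \<epsilon> sm sp"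
    and "x sp = Some (of_real ninf)" and "x sm = Some (- of_real ninf)"
    and "lam0 > 0"
  defines "B \<equiv> switch_points n1 n2 Y"
  defines "Icentr \<equiv> central_layer sm sp B"
    and "Iplus \<equiv> right_edge_layer sm sp B"
    and "Iminus \<equiv> left_edge_layer sm sp B"
    and "ecentr \<equiv> eps_centr \<epsilon> sm sp B"
    and "eedge \<equiv> eps_edge \<epsilon> sm sp B"
  assumes "Icentr \<noteq> {sm<..<sp}"
  shows
    "(\<forall>I. ordinary_layer \<epsilon> sm sp B I \<longrightarrow>
        (\<exists>j. I = {b j<..<b (j + 1)}
           \<and> (ess_right_lim \<epsilon> (b j) (n1\<^sup>2) \<longrightarrow> len I < pi / (2 * n1 * Re \<kappa>))
           \<and> (ess_right_lim \<epsilon> (b j) (n2\<^sup>2) \<longrightarrow>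
                pi / (2 * n2 * Re \<kappa>) < len I \<and> len I < pi / (n2 * Re \<kappa>))))
     \<and> ((eedge = n1\<^sup>2 \<longrightarrow>
           len Iplus < pi / (2 * n1 * Re \<kappa>) \<and> len Iminus < pi / (2 * n1 * Re \<kappa>))
        \<and> (eedge = n2\<^sup>2 \<longrightarrow>
           len Iplus < pi / (n1 * Re \<kappa>) \<and> len Iminus < pi / (n1 * Re \<kappa>))
        \<and> (ninf = n2 \<longrightarrow> eedge = n1\<^sup>2)
        \<and> (ninf = n1 \<longrightarrow> eedge = n2\<^sup>2))
     \<and> (x 0 = Some 0 \<longrightarrow> len Icentr < pi / (sqrt ecentr * Re \<kappa>))
     \<and> (x 0 = None \<and> ninf \<in> {n1..n2} \<longrightarrow>
          (ecentr = n2\<^sup>2 \<longrightarrow>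
             pi / (n2 * Re \<kappa>) < len Icentr \<and> len Icentr < 2 * pi / (n2 * Re \<kappa>))
          \<and> (ecentr = n1\<^sup>2 \<longrightarrow> len Icentr < pi / (n1 * Re \<kappa>)))"
proof -
  have sm: "sm = - sp" using \<open>sp = - sm\<close> by simp
  define d where "d s = vector_derivative Y (at s)" for s
  have sol: "solves_ode UNIV (\<lambda>s. - \<kappa>\<^sup>2 * of_real (control n1 n2 (Y s))) Y"
    and Yy: "\<And>s. s \<in> {- sp..sp} \<Longrightarrow> Y s = y s"
    using \<open>extends_to n1 n2 \<kappa> sm sp y Y\<close> by (auto simp: extends_to_def sm)
  have Y_deriv: "(Y has_vector_derivative d s) (at s)" for s
    using sol by (simp add: solves_ode_def d_def vector_derivative_works)
  have dy: "vector_derivative y (at s within {- sp..sp}) = d s" if s: "s \<in> {- sp..sp}" for s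
  proof -
    have "(y has_vector_derivative d s) (at s within {- sp..sp})"
      by (rule has_vector_derivative_transform[OF s _ has_vector_derivative_at_within[OF Y_deriv]])
         (simp add: Yy)
    then show ?thesis
      using vector_derivative_within_cbox[of "- sp" sp s y "d s"] s \<open>sp > 0\<close> by (simp add: cbox_interval)
  qed
  have tuple: "AE s\<in>{- sp..sp} in lebesgue.
      (Im ((y s)\<^sup>2) < 0 \<longrightarrow> \<epsilon> s = n1\<^sup>2) \<and> (Im ((y s)\<^sup>2) > 0 \<longrightarrow> \<epsilon> s = n2\<^sup>2)"
    "\<And>s. s \<in> {- sp..sp} \<Longrightarrow> x s = (if y s = 0 then None
        else Some (vector_derivative y (at s within {- sp..sp}) / (\<i> * \<kappa> * y s)))"
    "AE s\<in>{- sp..sp} in lebesgue.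
      Im (of_real (\<epsilon> s) * (y s)\<^sup>2 + (vector_derivative y (at s within {- sp..sp}))\<^sup>2 / \<kappa>\<^sup>2) = lam0"
    using \<open>extremal_tuple n1 n2 \<kappa> sm sp x \<epsilon> lam0 y\<close> unfolding extremal_tuple_def Let_def sm by blast+
  have x_eq: "x s = (if Y s = 0 then None else Some (d s / (\<i> * \<kappa> * Y s)))" if "s \<in> {- sp..sp}" for s
    using tuple(2)[OF that] by (simp add: dy[OF that] Yy[OF that])
  have \<kappa>_nz: "\<kappa> \<noteq> 0" using \<open>Re \<kappa> > 0\<close> by auto
  interpret extremal_profile n1 n2 ninf lam0 sp \<kappa> \<epsilon> Y d b
  proof
    show "((\<lambda>r. - \<kappa>\<^sup>2 * of_real (control n1 n2 (Y r)) * Y r) has_integral d t - d s) {s..t}" if "s \<le> t" for s t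
      using sol that by (simp add: solves_ode_def d_def)
    show "AE s in lebesgue. \<epsilon> (- s) = \<epsilon> s"
      using \<open>\<epsilon> \<in> Fsym n1 n2 ninf\<close> by (simp add: Fsym_def)
    show "AE s\<in>{- sp..sp} in lebesgue.
      (Im ((Y s)\<^sup>2) < 0 \<longrightarrow> \<epsilon> s = n1\<^sup>2) \<and> (Im ((Y s)\<^sup>2) > 0 \<longrightarrow> \<epsilon> s = n2\<^sup>2)"
      using tuple(1) by eventually_elim (simp add: Yy)
    show "AE s\<in>{- sp..sp} in lebesgue. Im (of_real (\<epsilon> s) * (Y s)\<^sup>2 + (d s)\<^sup>2 / \<kappa>\<^sup>2) = lam0"
      using tuple(3) by eventually_elim (simp add: Yy dy)
    have xp: "Y sp \<noteq> 0 \<and> d sp / (\<i> * \<kappa> * Y sp) = of_real ninf"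
      using x_eq[of sp] \<open>x sp = Some (of_real ninf)\<close> \<open>sp > 0\<close> by (simp split: if_splits)
    have xm: "Y (- sp) \<noteq> 0 \<and> d (- sp) / (\<i> * \<kappa> * Y (- sp)) = - of_real ninf"
      using x_eq[of "- sp"] \<open>x sm = Some (- of_real ninf)\<close> \<open>sp > 0\<close> by (simp add: sm split: if_splits)
    have "i * \<kappa> * z \<noteq> 0" if "z \<noteq> 0" "i \<noteq> 0" for i z using that \<kappa>_nz by simp
    then have "d sp = of_real ninf * (\<i> * \<kappa> * Y sp)" "d (- sp) = - of_real ninf * (\<i> * \<kappa> * Y (- sp))"
      using xp xm complex_i_not_zero by (metis nonzero_divide_eq_eq)+
    then show "d sp = \<i> * \<kappa> * of_real ninf * Y sp" "d (- sp) = - (\<i> * \<kappa> * of_real ninf * Y (- sp))"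
      by (simp_all add: mult_ac)
  qed (use assms Y_deriv in auto)
  interpret layered_profile n1 n2 ninf lam0 sp \<kappa> \<epsilon> Y d b
    by unfold_locales (use \<open>Icentr \<noteq> {sm<..<sp}\<close> in \<open>simp add: Icentr_def B_def sm\<close>)
  have lens: "len Icentr = 2 * first_switch" "len Iplus = sp - last_switch" "len Iminus = sp - last_switch"
    using first_switch_facts(2) last_switch_facts(3)
    by (auto simp: Icentr_def Iplus_def Iminus_def B_def sm central_layer_eq left_edge_eq right_edge_eq len_interval)
  have even: "d 0 = 0" if "x 0 = Some 0"
    using x_eq[of 0] that \<open>sp > 0\<close> \<kappa>_nz by (simp split: if_splits)
  have odd: "Y 0 = 0" if "x 0 = None"
    using x_eq[of 0] that \<open>sp > 0\<close> by (simp split: if_splits)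
  show ?thesis
    unfolding lens
    using ordinary_layer_bounds edge_bounds central_bounds_even[OF even] central_bounds_odd[OF odd]
    unfolding B_def ecentr_def eedge_def sm by blast
qed

end
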